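(* For every $n\ge1$, the set $\mathfrak M_n$ of minimal factorizations of the $n$-cycle and the set $\mathfrak U_n$ of labelled bi-type trees are in bijection.
   Context: Minimal factorizations. Let $\mathfrak S_n$ be the symmetric group on $\{1,\dots,n\}$, $c_n=(1\,2\cdots n)$, and $\ell(\tau)$ the length of a cycle $\tau$. Products are read from left to right ($\tau_1\tau_2$ means $\tau_2\circ\tau_1$). $\mathfrak M_n^{(k)}$ is the set of $k$-tuples of cycles $(\tau_1,\dots,\tau_k)$ of $\mathfrak S_n$ with $\ell(\tau_i)\ge2$ for all $i$, $\tau_1\cdots\tau_k=c_n$ and $\sum_{i=1}^k(\ell(\tau_i)-1)=n-1$; $\mathfrak M_n=\bigcup_{k=1}^{n-1}\mathfrak M_n^{(k)}$. Trees. Trees are finite rooted plane (ordered) trees. $\mathfrak U_n$ is the set of trees $T$ such that: (a) $T$ is bi-type: vertices at even height are white and vertices at odd height are black; (b) the root and all leaves are white (every black vertex has at least one child); (c) $T$ has $n$ white vertices and at least one black vertex; (d) the black vertices are labelled bijectively by $1,\dots,N^\bullet(T)$, where $N^\bullet(T)$ is the number of black vertices, in such a way that the labels of the children of the root are decreasing from left to right and, around every white vertex, the labels of its neighbours (parent and children) are sorted in decreasing clockwise order starting from one of these neighbours, i.e. for a non-root white vertex the sequence (label of parent, labels of children from left to right) is a cyclic rotation of a decreasing sequence. *)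

theory Defs
  imports "HOL-Combinatorics.Cycles"
begin

section \<open>Minimal factorizations\<close>

definition is_cycle :: "('a \<Rightarrow> 'a) \<Rightarrow> bool" where
  "is_cycle \<tau> \<longleftrightarrow> (\<exists>cs. cycle cs \<and> \<tau> = cycle_of_list cs)"

text \<open>The length is the number of moved points, which is the usual length as soon as that length
  is at least 2 (see \<open>cycle_length_cycle_of_list\<close>); the identity gets the value 0, so it is
  excluded by the condition \<open>cycle_length \<tau> \<ge> 2\<close>.\<close>

definition cycle_length :: "('a \<Rightarrow> 'a) \<Rightarrow> nat" where
  "cycle_length \<tau> = card {x. \<tau> x \<noteq> x}"

definition long_cycle :: "nat \<Rightarrow> nat \<Rightarrow> nat" where
  "long_cycle n = cycle_of_list [1..<Suc n]"

text \<open>Left-to-right product: \<open>prod_lr [\<tau>\<^sub>1, \<tau>\<^sub>2] = \<tau>\<^sub>2 \<circ> \<tau>\<^sub>1\<close>.\<close>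

definition prod_lr :: "('a \<Rightarrow> 'a) list \<Rightarrow> 'a \<Rightarrow> 'a" where
  "prod_lr \<tau>s = fold (\<circ>) \<tau>s id"

definition min_factorizations_k :: "nat \<Rightarrow> nat \<Rightarrow> (nat \<Rightarrow> nat) list set" where
  "min_factorizations_k n k =
    {\<tau>s. length \<tau>s = k
        \<and> (\<forall>\<tau>\<in>set \<tau>s. \<tau> permutes {1..n} \<and> is_cycle \<tau> \<and> cycle_length \<tau> \<ge> 2)
        \<and> prod_lr \<tau>s = long_cycle n
        \<and> (\<Sum>\<tau>\<leftarrow>\<tau>s. cycle_length \<tau> - 1) = n - 1}"

definition min_factorizations :: "nat \<Rightarrow> (nat \<Rightarrow> nat) list set" where
  "min_factorizations n = (\<Union>k\<in>{1..n-1}. min_factorizations_k n k)"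

lemma cycle_length_cycle_of_list:
  assumes "cycle cs" and "length cs \<ge> 2"
  shows "cycle_length (cycle_of_list cs) = length cs"
proof -
  have rot: "map (cycle_of_list cs) cs = rotate1 cs"
    using cyclic_rotation[OF assms(1), of 1] by (simp del: cycle_of_list.simps)
  have "cycle_of_list cs x \<noteq> x" if x: "x \<in> set cs" for x
  proof -
    obtain i where i: "i < length cs" "x = cs ! i"
      using x by (auto simp: in_set_conv_nth)
    have "cycle_of_list cs x = cs ! (Suc i mod length cs)"
      using arg_cong[OF rot, of "\<lambda>xs. xs ! i"] i by (simp add: nth_rotate1)
    moreover have "Suc i mod length cs \<noteq> i"
      using i assms(2) by (cases "Suc i = length cs") auto
    moreover have "Suc i mod length cs < length cs"
      using assms(2) by (intro mod_less_divisor) linarith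
    ultimately show ?thesis
      using i assms(1) by (simp add: nth_eq_iff_index_eq)
  qed
  then have "{x. cycle_of_list cs x \<noteq> x} = set cs"
    using id_outside_supp[of _ cs] by blast
  then show ?thesis
    using assms(1) by (simp add: cycle_length_def distinct_card)
qed

lemma prod_lr_pair: "prod_lr [\<tau>\<^sub>1, \<tau>\<^sub>2] = \<tau>\<^sub>2 \<circ> \<tau>\<^sub>1"
  by (simp add: prod_lr_def)

lemma long_cycle_apply:
  assumes "i \<in> {1..n}"
  shows "long_cycle n i = (if i = n then 1 else Suc i)"
proof -
  have "map (long_cycle n) [1..<Suc n] = rotate1 [1..<Suc n]"
    using cyclic_rotation[of "[1..<Suc n]" 1] by (simp add: long_cycle_def del: upt_Suc)
  from arg_cong[OF this, of "\<lambda>xs. xs ! (i - 1)"]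
  have eq: "map (long_cycle n) [1..<Suc n] ! (i - 1) = rotate1 [1..<Suc n] ! (i - 1)" .
  have i: "i - 1 < n" "1 + (i - 1) = i" "Suc (i - 1) = i"
    using assms by auto
  have "map (long_cycle n) [1..<Suc n] ! (i - 1) = long_cycle n i"
    using i by (subst nth_map_upt) simp_all
  moreover have "rotate1 [1..<Suc n] ! (i - 1) = [1..<Suc n] ! (i mod n)"
    using i by (subst nth_rotate1) (simp_all del: upt_Suc)
  moreover have "[1..<Suc n] ! (i mod n) = 1 + i mod n"
    using assms by (intro nth_upt) simp
  ultimately have "long_cycle n i = 1 + i mod n"
    using eq by simp
  then show ?thesis
    using assms by auto
qed


section \<open>Labelled bi-type trees\<close>

text \<open>Finite rooted plane trees with white vertices at even height and labelled black vertices at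
  odd height: a \<open>white_tree\<close> is a tree rooted at a white vertex, a \<open>black_tree\<close> is a subtree
  rooted at a black vertex, and the lists give the children from left to right.\<close>

datatype white_tree = White "black_tree list"
  and black_tree = Black (label: nat) "white_tree list"

fun num_white :: "white_tree \<Rightarrow> nat" and num_white_b :: "black_tree \<Rightarrow> nat" where
  "num_white (White bs) = 1 + (\<Sum>b\<leftarrow>bs. num_white_b b)"
| "num_white_b (Black l ws) = (\<Sum>w\<leftarrow>ws. num_white w)"

text \<open>The labels of all black vertices, one list entry for each black vertex.\<close>

fun black_labels :: "white_tree \<Rightarrow> nat list" and black_labels_b :: "black_tree \<Rightarrow> nat list" where
  "black_labels (White bs) = concat (map black_labels_b bs)"
| "black_labels_b (Black l ws) = l # concat (map black_labels ws)"

definition num_black :: "white_tree \<Rightarrow> nat" where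
  "num_black t = length (black_labels t)"

fun leaves_white :: "white_tree \<Rightarrow> bool" and leaves_white_b :: "black_tree \<Rightarrow> bool" where
  "leaves_white (White bs) \<longleftrightarrow> (\<forall>b\<in>set bs. leaves_white_b b)"
| "leaves_white_b (Black l ws) \<longleftrightarrow> ws \<noteq> [] \<and> (\<forall>w\<in>set ws. leaves_white w)"

definition decreasing :: "nat list \<Rightarrow> bool" where
  "decreasing xs \<longleftrightarrow> sorted_wrt (>) xs"

definition cyclically_decreasing :: "nat list \<Rightarrow> bool" where
  "cyclically_decreasing xs \<longleftrightarrow> (\<exists>ys m. decreasing ys \<and> xs = rotate m ys)"

text \<open>The sorting condition around all vertices of a subtree hanging below the root; the first
  argument of \<open>sorted_white\<close> is the label of the black parent of the white vertex.\<close>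

fun sorted_white :: "nat \<Rightarrow> white_tree \<Rightarrow> bool" and sorted_black :: "black_tree \<Rightarrow> bool" where
  "sorted_white p (White bs) \<longleftrightarrow>
     cyclically_decreasing (p # map label bs) \<and> (\<forall>b\<in>set bs. sorted_black b)"
| "sorted_black (Black l ws) \<longleftrightarrow> (\<forall>w\<in>set ws. sorted_white l w)"

fun sorted_root :: "white_tree \<Rightarrow> bool" where
  "sorted_root (White bs) \<longleftrightarrow> decreasing (map label bs) \<and> (\<forall>b\<in>set bs. sorted_black b)"

text \<open>The conditions on \<open>black_labels\<close> say that the labelling is a bijection from the black vertices
  onto \<open>{1..num_black t}\<close>.\<close>

definition labelled_trees :: "nat \<Rightarrow> white_tree set" where
  "labelled_trees n =
    {t. leaves_white t
        \<and> num_white t = n \<and> num_black t \<ge> 1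
        \<and> distinct (black_labels t) \<and> set (black_labels t) = {1..num_black t}
        \<and> sorted_root t}"

end

theory Submission
  imports Defs
begin

text \<open>Both sides have the same recursive structure with respect to the largest label \<open>N\<close>. Deleting the
  black vertex \<open>N\<close> from a labelled tree leaves the tree of the root, with a marked white vertex, and a
  nonempty sequence of trees below \<open>N\<close>; conversely a vertex with a new largest label can be inserted at
  a given white vertex in exactly one way. Deleting the factor \<open>\<tau>\<^sub>N\<close> from a minimal factorization of
  the cycle through \<open>xs\<close> leaves minimal factorizations of disjoint cycles: minimality forces the points
  moved by \<open>\<tau>\<^sub>N\<close> to lie in different components of the remaining factors, so that
  \<open>xs = us @ concat bs @ vs\<close>, where \<open>\<tau>\<^sub>N\<close> is the cycle through the first elements of the lists \<open>bs\<close> and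
  of \<open>vs\<close>, and the remaining cycles run through \<open>us @ vs\<close> and through the members of \<open>bs\<close>. The length
  of \<open>us\<close> plays the part of the marked white vertex.\<close>

section \<open>Minimal factorizations of products of disjoint cycles\<close>

text \<open>Deleting the largest label leaves pieces whose words and label sets are arbitrary. The
  recursion is therefore run for words over any type, for factors indexed by labels with gaps, and
  for trees with any distinct positive labels; the labels \<open>{1..k}\<close> and the word
  \<open>1, ..., n\<close> return only at the end. Label 0 is kept free: as virtual parent of the
  root it turns the root condition into the condition at other white vertices. Since a parent label
  below all others and one above all others impose the same order, the trees below \<open>N\<close>
  can be read as rooted trees themselves. The cut of \<open>us @ vs\<close> and the white vertex of
  the smaller tree are matched by number alone: both take as many values as that tree has white
  vertices, because \<open>vs\<close> is nonempty. The separation forced by minimality comes from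
  counting components: a factor of length m merges at most m classes, so it lowers their number by
  at most m - 1. The correspondence is an inductive relation, shown to be total and unique in both
  directions.\<close>

text \<open>The cycle through \<open>b\<close> sends its last element to \<open>hd b\<close>, which
  the transposition redirects to \<open>hd w\<close>, and likewise back from \<open>w\<close> to
  \<open>b\<close>: two disjoint cycles become one.\<close>

lemma cycle_of_list_append:
  assumes "b \<noteq> []" "w \<noteq> []" "distinct (b @ w)"
  shows "cycle_of_list (b @ w) =
    transpose (hd b) (hd w) \<circ> cycle_of_list w \<circ> cycle_of_list b"
  using assms
proof (induction b rule: cycle_of_list.induct)
  case (1 x y b)
  let ?h = "hd w"
  have neq: "x \<noteq> y" "x \<noteq> ?h" "y \<noteq> ?h" "x \<notin> set w" "y \<notin> set w"
    using 1(2-4) by (cases w; auto)+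
  have fix_w: "cycle_of_list w z \<notin> {x, y} \<and> z \<noteq> x \<and> z \<noteq> y" if "z \<in> set w" for z
    using that neq permutes_in_image[OF cycle_permutes[of w], of z] by auto
  have comm: "transpose x y \<circ> cycle_of_list w = cycle_of_list w \<circ> transpose x y"
  proof
    fix z
    show "(transpose x y \<circ> cycle_of_list w) z = (cycle_of_list w \<circ> transpose x y) z"
    proof (cases "z \<in> set w")
      case True
      then show ?thesis using fix_w by (auto simp: transpose_def)
    next
      case False
      then show ?thesis using neq by (auto simp: transpose_def id_outside_supp)
    qed
  qed
  \<comment> \<open>The induction hypothesis joins at \<open>y\<close>; conjugation by the first
    transposition moves the junction to the new head \<open>x\<close>.\<close>
  have tr: "transpose x y \<circ> transpose y ?h = transpose x ?h \<circ> transpose x y"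
    using neq by (auto simp: transpose_def fun_eq_iff)
  have "cycle_of_list ((x # y # b) @ w) =
      transpose x y \<circ> (transpose y ?h \<circ> cycle_of_list w \<circ> cycle_of_list (y # b))"
    using 1 by (simp only: append_Cons cycle_of_list.simps) (simp add: fun_eq_iff)
  also have "\<dots> = transpose x ?h \<circ> (transpose x y \<circ> cycle_of_list w) \<circ> cycle_of_list (y # b)"
    by (simp only: comp_assoc[symmetric] tr)
  also have "\<dots> = transpose x ?h \<circ> cycle_of_list w \<circ> cycle_of_list (x # y # b)"
    by (simp only: comm) (simp add: comp_assoc)
  finally show ?case by (simp only: list.sel)
qed (auto simp: neq_Nil_conv)

lemma cycle_of_list_swap:
  assumes "distinct (xs @ ys)"
  shows "cycle_of_list (xs @ ys) = cycle_of_list (ys @ xs)"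
  using cycle_of_list_rotate_independent[OF assms, of "length xs"] by (simp add: rotate_append)

lemma cycle_of_list_nth:
  assumes "distinct xs" "Suc i < length xs"
  shows "cycle_of_list xs (xs ! i) = xs ! Suc i"
  using arg_cong[OF cyclic_rotation[OF assms(1), of 1], of "\<lambda>ys. ys ! i"] assms(2)
  by (simp add: nth_rotate1 del: cycle_of_list.simps)

text \<open>The walk from \<open>hd xs\<close> reaches every element before the closing step back to
  \<open>hd xs\<close>, hence the guard. In \<open>min_fact_Suc_split\<close> invariance is first
  known only for steps that do not end at a head.\<close>

lemma constant_if_cycle_invariant:
  assumes "distinct xs"
    and "\<And>a. a \<in> set xs \<Longrightarrow> cycle_of_list xs a \<noteq> hd xs \<Longrightarrow> f (cycle_of_list xs a) = f a"
    and "a \<in> set xs"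
  shows "f a = f (hd xs)"
proof -
  have "i < length xs \<Longrightarrow> f (xs ! i) = f (hd xs)" for i
  proof (induction i)
    case 0
    then show ?case by (simp add: hd_conv_nth)
  next
    case (Suc i)
    have "xs ! Suc i \<noteq> hd xs"
      using Suc.prems assms(1) nth_eq_iff_index_eq[OF assms(1), of "Suc i" 0]
      by (cases "xs = []") (auto simp: hd_conv_nth)
    then show ?case
      using Suc assms(2)[of "xs ! i"] cycle_of_list_nth[OF assms(1) Suc.prems] by simp
  qed
  then show ?thesis
    using assms(3) by (metis in_set_conv_nth)
qed

lemma moved_cycle_of_list:
  assumes "distinct cs" "length cs \<ge> 2"
  shows "{x. cycle_of_list cs x \<noteq> x} = set cs"
proof -
  have "card (set cs) = card {x. cycle_of_list cs x \<noteq> x}"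
    using cycle_length_cycle_of_list[OF assms] assms(1) by (simp add: cycle_length_def distinct_card)
  moreover have "{x. cycle_of_list cs x \<noteq> x} \<subseteq> set cs"
    using id_outside_supp[of _ cs] by blast
  ultimately show ?thesis
    by (simp add: card_subset_eq)
qed

lemma cycle_of_list_short: "length cs < 2 \<Longrightarrow> cycle_of_list cs = id"
  by (induction cs rule: cycle_of_list.induct) auto

lemma disjoint_permutes_commute:
  assumes "p permutes A" "q permutes B" "A \<inter> B = {}"
  shows "p \<circ> q = q \<circ> p"
proof
  fix x
  have "x \<in> A \<Longrightarrow> x \<notin> B \<and> p x \<notin> B" "x \<in> B \<Longrightarrow> x \<notin> A \<and> q x \<notin> A"
    using assms permutes_in_image[OF assms(1), of x] permutes_in_image[OF assms(2), of x] by auto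
  then show "(p \<circ> q) x = (q \<circ> p) x"
    using assms(1,2) by (metis comp_apply permutes_not_in)
qed

fun cycles_of_lists :: "'a list list \<Rightarrow> 'a \<Rightarrow> 'a" where
  "cycles_of_lists [] = id"
| "cycles_of_lists (b # bs) = cycle_of_list b \<circ> cycles_of_lists bs"

lemma cycles_of_lists_permutes: "cycles_of_lists bs permutes set (concat bs)"
proof (induction bs)
  case (Cons b bs)
  have "cycle_of_list b permutes set (concat (b # bs))"
    "cycles_of_lists bs permutes set (concat (b # bs))"
    using permutes_subset[OF cycle_permutes[of b]] permutes_subset[OF Cons.IH] by auto
  then show ?case
    using permutes_compose[of "cycles_of_lists bs" _ "cycle_of_list b"] by (simp only: cycles_of_lists.simps)
qed (simp only: cycles_of_lists.simps permutes_id)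

lemma cycles_of_lists_append:
  "cycles_of_lists (bs @ bs') = cycles_of_lists bs \<circ> cycles_of_lists bs'"
  by (induction bs) (auto simp: comp_assoc)

lemma cycles_of_lists_apply:
  assumes "distinct (concat bs)" "b \<in> set bs" "x \<in> set b"
  shows "cycles_of_lists bs x = cycle_of_list b x"
  using assms
proof (induction bs)
  case (Cons c bs)
  show ?case
  proof (cases "x \<in> set c")
    case True
    then have "x \<notin> set (concat bs)" "b = c \<or> b \<notin> set bs"
      using Cons.prems by auto
    then have "b = c"
      using Cons.prems by auto
    then show ?thesis
      using permutes_not_in[OF cycles_of_lists_permutes, of x bs] \<open>x \<notin> set (concat bs)\<close> by simp
  next
    case False
    then have b: "b \<in> set bs"
      using Cons.prems by auto
    then have "cycle_of_list b x \<in> set (concat bs)"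
      using Cons.prems(3) permutes_in_image[OF cycle_permutes[of b]] by auto
    then have "cycle_of_list b x \<notin> set c"
      using Cons.prems(1) by auto
    then show ?thesis
      using Cons b by (auto simp: id_outside_supp)
  qed
qed auto

text \<open>Peeling off the blocks of \<open>bs\<close> one at a time by
  \<open>cycle_of_list_append\<close> produces transpositions of consecutive heads, and these
  multiply to the cycle through the heads. The word is read cyclically, so \<open>us\<close> and
  \<open>vs\<close> stay together and are joined at \<open>hd vs\<close>.\<close>

lemma cycle_of_list_split:
  assumes "vs \<noteq> []" "[] \<notin> set bs" "distinct (us @ concat bs @ vs)"
  shows "cycle_of_list (us @ concat bs @ vs) =
    cycle_of_list (map hd bs @ [hd vs]) \<circ> cycles_of_lists ((us @ vs) # bs)"
  using assms(2,3)
proof (induction bs)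
  case (Cons b bs)
  let ?w = "concat bs @ vs"
  have w: "?w \<noteq> []" "b \<noteq> []"
    using assms(1) Cons.prems by auto
  have hd_w: "hd ?w = hd (map hd bs @ [hd vs])"
    using Cons.prems by (cases bs) auto
  \<comment> \<open>Rotating \<open>us\<close> to the end brings the block \<open>b\<close> to the
    front, where it can be split off.\<close>
  have "cycle_of_list (us @ b @ ?w) = cycle_of_list (b @ (?w @ us))"
    using cycle_of_list_swap[of us "b @ ?w"] Cons.prems by simp
  also have "\<dots> = transpose (hd b) (hd (?w @ us)) \<circ> cycle_of_list (?w @ us) \<circ> cycle_of_list b"
    by (rule cycle_of_list_append) (use w Cons.prems in auto)
  also have "hd (?w @ us) = hd ?w"
    using w(1) by (metis hd_append2)
  also have "cycle_of_list (?w @ us) = cycle_of_list (us @ ?w)"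
    by (rule cycle_of_list_swap) (use Cons.prems in auto)
  also have "\<dots> = cycle_of_list (map hd bs @ [hd vs]) \<circ> cycles_of_lists ((us @ vs) # bs)"
    by (rule Cons.IH) (use Cons.prems in auto)
  finally have "cycle_of_list (us @ b @ ?w) =
      (transpose (hd b) (hd ?w) \<circ> cycle_of_list (map hd bs @ [hd vs]))
      \<circ> (cycle_of_list (us @ vs) \<circ> (cycles_of_lists bs \<circ> cycle_of_list b))"
    by (simp only: comp_assoc cycles_of_lists.simps)
  also have "cycles_of_lists bs \<circ> cycle_of_list b = cycle_of_list b \<circ> cycles_of_lists bs"
    by (rule disjoint_permutes_commute[OF cycles_of_lists_permutes cycle_permutes])
      (use Cons.prems in auto)
  also have "transpose (hd b) (hd ?w) \<circ> cycle_of_list (map hd bs @ [hd vs]) =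
      cycle_of_list (map hd (b # bs) @ [hd vs])"
    using hd_w by (cases "map hd bs @ [hd vs]") auto
  finally show ?case
    by simp
qed simp

section \<open>Products of factors indexed by labels, and the components they generate\<close>

fun ordered_prod :: "(nat \<Rightarrow> 'a \<Rightarrow> 'a) \<Rightarrow> nat \<Rightarrow> 'a \<Rightarrow> 'a" where
  "ordered_prod \<tau> 0 = id"
| "ordered_prod \<tau> (Suc K) = \<tau> K \<circ> ordered_prod \<tau> K"

lemma ordered_prod_cong: "(\<And>l. l < K \<Longrightarrow> \<tau> l = \<tau>' l) \<Longrightarrow> ordered_prod \<tau> K = ordered_prod \<tau>' K"
  by (induction K) auto

lemma ordered_prod_permutes:
  assumes "\<And>l. l < K \<Longrightarrow> \<tau> l permutes A"
  shows "ordered_prod \<tau> K permutes A"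
  using assms by (induction K) (auto simp: permutes_id intro!: permutes_compose)

text \<open>The two families have disjoint supports, so \<open>\<tau>' K\<close> can be moved past
  the earlier factors of \<open>\<tau>\<close>.\<close>

lemma ordered_prod_comp:
  assumes "\<And>l. \<tau> l permutes A" "\<And>l. \<tau>' l permutes B" "A \<inter> B = {}"
  shows "ordered_prod (\<lambda>l. \<tau> l \<circ> \<tau>' l) K = ordered_prod \<tau> K \<circ> ordered_prod \<tau>' K"
proof (induction K)
  case (Suc K)
  have "\<tau>' K \<circ> ordered_prod \<tau> K = ordered_prod \<tau> K \<circ> \<tau>' K"
    by (rule disjoint_permutes_commute[OF assms(2) ordered_prod_permutes]) (use assms in auto)
  then show ?case
    by (simp only: ordered_prod.simps Suc.IH) (simp add: fun_eq_iff)
qed simp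

lemma ordered_prod_extend:
  assumes "K \<le> K'" "\<And>l. l \<ge> K \<Longrightarrow> \<tau> l = id"
  shows "ordered_prod \<tau> K' = ordered_prod \<tau> K"
  using assms(1) by (induction K' rule: dec_induct) (simp_all add: assms(2))

lemma disjoint_permutes_comp_unique:
  assumes "p permutes A" "q permutes B" "A \<inter> B = {}" "p \<circ> q = p' \<circ> q'" "p' permutes A" "q' permutes B"
  shows "p = p' \<and> q = q'"
proof
  show "p = p'"
  proof
    fix x
    show "p x = p' x"
    proof (cases "x \<in> A")
      case True
      then have "q x = x" "q' x = x"
        using assms by (auto simp: permutes_not_in disjoint_iff)
      then show ?thesis
        using fun_cong[OF assms(4), of x] by simp
    qed (use assms in \<open>auto simp: permutes_not_in\<close>)
  qed
  with assms(1,4) show "q = q'"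
    using permutes_inj[OF assms(1)] by (metis fun.inj_map_strong injD comp_apply ext)
qed

text \<open>The map \<open>f\<close> names the connected components of the hypergraph on \<open>S\<close> with hyperedges \<open>X l\<close>.\<close>

lemma component_map:
  fixes S :: "'a set" and K :: nat
  assumes "finite S" "\<And>l. l < K \<Longrightarrow> X l \<subseteq> S"
  shows "\<exists>f :: 'a \<Rightarrow> 'a. (\<forall>l<K. \<forall>x\<in>X l. \<forall>y\<in>X l. f x = f y)
    \<and> card S \<le> card (f ` S) + (\<Sum>l<K. card (X l) - 1)"
  using assms(2)
proof (induction K)
  case 0
  show ?case by (intro exI[of _ "\<lambda>x. x"]) simp
next
  case (Suc K)
  from Suc.IH[OF Suc.prems[OF less_SucI]]
  obtain f :: "'a \<Rightarrow> 'a" where f: "\<forall>l<K. \<forall>x\<in>X l. \<forall>y\<in>X l. f x = f y"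
    "card S \<le> card (f ` S) + (\<Sum>l<K. card (X l) - 1)"
    by blast
  show ?case
  proof (cases "X K = {}")
    case True
    have "\<forall>l<Suc K. \<forall>x\<in>X l. \<forall>y\<in>X l. f x = f y"
      using f(1) True by (metis less_Suc_eq empty_iff)
    moreover have "card S \<le> card (f ` S) + (\<Sum>l<Suc K. card (X l) - 1)"
      using f(2) True by simp
    ultimately show ?thesis by blast
  next
    case False
    then obtain x0 where x0: "x0 \<in> X K" by auto
    have XS: "X K \<subseteq> S" using Suc.prems by simp
    have fin: "finite (X K)" using XS assms(1) finite_subset by blast
    \<comment> \<open>All names met by \<open>X K\<close> are merged into the name of
      \<open>x0\<close>, so at most \<open>card (X K) - 1\<close> names disappear.\<close>
    define g where "g y = (if f y \<in> f ` X K then f x0 else f y)" for y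
    have "insert (f x0) (f ` S - f ` X K) \<subseteq> g ` S"
      using x0 XS by (auto simp: g_def image_iff)
    then have "Suc (card (f ` S - f ` X K)) \<le> card (g ` S)"
      using card_mono[of "g ` S" "insert (f x0) (f ` S - f ` X K)"] assms(1) x0
      by (simp add: card_insert_if)
    moreover have "card (f ` S) - card (f ` X K) \<le> card (f ` S - f ` X K)"
      by (rule diff_card_le_card_Diff) (use fin in simp)
    moreover have "card (f ` X K) \<le> card (X K)"
      using fin by (rule card_image_le)
    moreover have "card (X K) \<ge> 1"
      using False fin by (simp add: card_gt_0_iff Suc_le_eq)
    ultimately have "card S \<le> card (g ` S) + (\<Sum>l<Suc K. card (X l) - 1)"
      using f(2) by simp
    moreover have "\<forall>l<Suc K. \<forall>x\<in>X l. \<forall>y\<in>X l. g x = g y"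
    proof (intro allI impI ballI)
      fix l x y assume *: "l < Suc K" "x \<in> X l" "y \<in> X l"
      show "g x = g y"
      proof (cases "l = K")
        case True
        then show ?thesis using * by (auto simp: g_def)
      next
        case False
        then have "f x = f y" using * f(1) by (metis less_SucE)
        then show ?thesis by (auto simp: g_def)
      qed
    qed
    ultimately show ?thesis by blast
  qed
qed

text \<open>By injectivity a factor sends each moved point to a point that it also moves, and
  \<open>f\<close> is constant on those; so no partial product leaves a component.\<close>

lemma ordered_prod_invariant:
  assumes "\<And>l. l < K \<Longrightarrow> inj (\<tau> l)"
    and "\<And>l x y. l < K \<Longrightarrow> \<tau> l x \<noteq> x \<Longrightarrow> \<tau> l y \<noteq> y \<Longrightarrow> f x = f y"
  shows "f (ordered_prod \<tau> K x) = f x"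
  using assms
proof (induction K)
  case (Suc K)
  let ?y = "ordered_prod \<tau> K x"
  have "f (\<tau> K ?y) = f ?y"
  proof (cases "\<tau> K ?y = ?y")
    case False
    then have "\<tau> K (\<tau> K ?y) \<noteq> \<tau> K ?y"
      using inj_eq[OF Suc.prems(1)[OF lessI]] by simp
    then show ?thesis using False by (rule Suc.prems(2)[OF lessI])
  qed simp
  moreover have "f ?y = f x"
  proof (rule Suc.IH)
    show "inj (\<tau> l)" if "l < K" for l
      using that by (intro Suc.prems(1)) simp
    show "f u = f v" if "l < K" "\<tau> l u \<noteq> u" "\<tau> l v \<noteq> v" for l u v
      using that less_SucI by (intro Suc.prems(2)[of l])
  qed
  ultimately show ?case by simp
qed simp

section \<open>Minimality as equality in a component count\<close>

definition excess :: "(nat \<Rightarrow> 'a \<Rightarrow> 'a) \<Rightarrow> nat \<Rightarrow> nat" where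
  "excess \<tau> K = (\<Sum>l<K. cycle_length (\<tau> l) - 1)"

text \<open>The factors are indexed by the labels below \<open>K\<close>; unused labels carry the identity.\<close>

definition min_fact :: "nat \<Rightarrow> 'a list list \<Rightarrow> (nat \<Rightarrow> 'a \<Rightarrow> 'a) \<Rightarrow> bool" where
  "min_fact K bs \<tau> \<longleftrightarrow>
     distinct (concat bs) \<and> [] \<notin> set bs
     \<and> (\<forall>l. \<tau> l permutes set (concat bs) \<and> is_cycle (\<tau> l)) \<and> (\<forall>l\<ge>K. \<tau> l = id)
     \<and> ordered_prod \<tau> K = cycles_of_lists bs
     \<and> excess \<tau> K = (\<Sum>b\<leftarrow>bs. length b - 1)"

lemma cycle_length_id: "cycle_length id = 0"
  by (simp add: cycle_length_def)

lemma is_cycle_id: "is_cycle id"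
  unfolding is_cycle_def by (rule exI[of _ "[]"]) simp

lemma excess_extend:
  assumes "K \<le> K'" "\<And>l. l \<ge> K \<Longrightarrow> \<tau> l = id"
  shows "excess \<tau> K' = excess \<tau> K"
  using assms(1) by (induction K' rule: dec_induct) (simp_all add: assms(2) excess_def cycle_length_id)

text \<open>Identity factors change neither the product nor the excess, so the bound may move in
  both directions as long as all nontrivial factors stay below it.\<close>

lemma min_fact_change_bound:
  assumes "min_fact K bs \<tau>" "\<And>l. l \<ge> K' \<Longrightarrow> \<tau> l = id"
  shows "min_fact K' bs \<tau>"
proof -
  have triv: "\<tau> l = id" if "K \<le> l" for l
    using assms(1) that by (simp add: min_fact_def)
  have "ordered_prod \<tau> K = ordered_prod \<tau> K' \<and> excess \<tau> K = excess \<tau> K'"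
  proof (cases "K \<le> K'")
    case True
    then show ?thesis
      by (simp only: ordered_prod_extend[OF True triv] excess_extend[OF True triv])
  next
    case False
    then have "K' \<le> K"
      by simp
    then show ?thesis
      by (simp only: ordered_prod_extend[OF _ assms(2)] excess_extend[OF _ assms(2)])
  qed
  then show ?thesis
    using assms by (simp add: min_fact_def)
qed

lemma excess_comp:
  assumes "\<And>l. \<tau> l = id \<or> \<tau>' l = id"
  shows "excess (\<lambda>l. \<tau> l \<circ> \<tau>' l) K = excess \<tau> K + excess \<tau>' K"
  unfolding excess_def sum.distrib[symmetric]
proof (rule sum.cong[OF refl])
  fix l
  show "cycle_length (\<tau> l \<circ> \<tau>' l) - 1 = (cycle_length (\<tau> l) - 1) + (cycle_length (\<tau>' l) - 1)"
    using assms[of l] by (auto simp: cycle_length_id)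
qed

text \<open>At each label one of the two factors is the identity, so the composed factor is still a
  single cycle and the excesses add up.\<close>

lemma min_fact_comp:
  assumes "min_fact K bs \<tau>" "min_fact K bs' \<tau>'"
    and "set (concat bs) \<inter> set (concat bs') = {}"
    and "\<And>l. \<tau> l = id \<or> \<tau>' l = id"
  shows "min_fact K (bs @ bs') (\<lambda>l. \<tau> l \<circ> \<tau>' l)"
proof -
  have perm: "\<tau> l permutes set (concat bs)" "\<tau>' l permutes set (concat bs')" for l
    using assms(1,2) by (simp_all add: min_fact_def)
  have "\<tau> l permutes set (concat (bs @ bs'))" "\<tau>' l permutes set (concat (bs @ bs'))" for l
    using permutes_subset[OF perm(1)] permutes_subset[OF perm(2)] by auto
  then have "\<tau> l \<circ> \<tau>' l permutes set (concat (bs @ bs'))" for l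
    using permutes_compose by blast
  moreover have "is_cycle (\<tau> l \<circ> \<tau>' l)" for l
    using assms(1,2) assms(4)[of l] by (auto simp: min_fact_def)
  ultimately show ?thesis
    using assms ordered_prod_comp[OF perm assms(3), where K = K] excess_comp[OF assms(4), where K = K]
    by (simp add: min_fact_def cycles_of_lists_append)
qed

lemma concat_blocks_length:
  "[] \<notin> set bs \<Longrightarrow> length (concat bs) = length bs + (\<Sum>b\<leftarrow>bs. length b - 1)"
  by (induction bs) (auto simp: Suc_le_eq)

text \<open>The product keeps every point in its component and runs through each block cyclically,
  so a block lies in one component. The last clause is the count: few components require a large
  excess.\<close>

lemma component_map_cycles:
  fixes bs :: "'a list list"
  assumes "distinct (concat bs)" "\<And>l. \<tau> l permutes set (concat bs)"
    and "ordered_prod \<tau> K = cycles_of_lists bs"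
  shows "\<exists>f :: 'a \<Rightarrow> 'a. (\<forall>l<K. \<forall>x y. \<tau> l x \<noteq> x \<longrightarrow> \<tau> l y \<noteq> y \<longrightarrow> f x = f y)
    \<and> (\<forall>b\<in>set bs. \<forall>x\<in>set b. f x = f (hd b))
    \<and> length (concat bs) \<le> card (f ` set (concat bs)) + excess \<tau> K"
proof -
  let ?S = "set (concat bs)"
  have sub: "{x. \<tau> l x \<noteq> x} \<subseteq> ?S" for l
    using permutes_not_in[OF assms(2)[of l]] by blast
  obtain f :: "'a \<Rightarrow> 'a" where f: "\<forall>l<K. \<forall>x\<in>{x. \<tau> l x \<noteq> x}. \<forall>y\<in>{x. \<tau> l x \<noteq> x}. f x = f y"
    "card ?S \<le> card (f ` ?S) + (\<Sum>l<K. card {x. \<tau> l x \<noteq> x} - 1)"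
    using component_map[of ?S K "\<lambda>l. {x. \<tau> l x \<noteq> x}", OF finite_set sub] by blast
  have inv: "f (cycles_of_lists bs x) = f x" for x
    unfolding assms(3)[symmetric]
    using f(1) by (intro ordered_prod_invariant permutes_inj[OF assms(2)]) blast
  have "f x = f (hd b)" if b: "b \<in> set bs" "x \<in> set b" for b x
  proof (rule constant_if_cycle_invariant[OF _ _ b(2)])
    show "distinct b"
      using assms(1) b(1) by (simp add: distinct_concat_iff)
    show "f (cycle_of_list b a) = f a" if "a \<in> set b" for a
      using inv[of a] cycles_of_lists_apply[OF assms(1) b(1) that] by simp
  qed
  moreover have "card ?S = length (concat bs)"
    using assms(1) by (rule distinct_card)
  ultimately have "length (concat bs) \<le> card (f ` set (concat bs)) + excess \<tau> K"
    "\<forall>b\<in>set bs. \<forall>x\<in>set b. f x = f (hd b)"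
    using f(2) unfolding excess_def cycle_length_def by (simp only:, blast)
  then show ?thesis
    using f(1) by blast
qed

lemma image_blocks:
  assumes "[] \<notin> set bs" "\<forall>b\<in>set bs. \<forall>x\<in>set b. f x = f (hd b)"
  shows "f ` set (concat bs) = set (map (f \<circ> hd) bs)"
proof -
  have "f ` set b = {f (hd b)}" if "b \<in> set bs" for b
  proof -
    have "hd b \<in> set b" using that assms(1) by (metis list.set_sel(1))
    then show ?thesis using assms(2) that by blast
  qed
  then have "(\<Union>b\<in>set bs. f ` set b) = (\<Union>b\<in>set bs. {f (hd b)})"
    by (intro SUP_cong) auto
  then show ?thesis
    by (simp add: image_UN) blast
qed

text \<open>Each block has a single component name, so there are at most \<open>length bs\<close>
  names, and the excess must pay for the descent from the number of points to that number.\<close>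

lemma excess_ge:
  fixes bs :: "'a list list"
  assumes "distinct (concat bs)" "[] \<notin> set bs" "\<And>l. \<tau> l permutes set (concat bs)"
    and "ordered_prod \<tau> K = cycles_of_lists bs"
  shows "(\<Sum>b\<leftarrow>bs. length b - 1) \<le> excess \<tau> K"
proof -
  obtain f :: "'a \<Rightarrow> 'a" where f: "\<forall>b\<in>set bs. \<forall>x\<in>set b. f x = f (hd b)"
    "length (concat bs) \<le> card (f ` set (concat bs)) + excess \<tau> K"
    using component_map_cycles[OF assms(1,3,4)] by blast
  have "card (f ` set (concat bs)) \<le> length bs"
    unfolding image_blocks[OF assms(2) f(1)] using card_length[of "map (f \<circ> hd) bs"] by simp
  then show ?thesis
    using f(2) concat_blocks_length[OF assms(2)] by simp
qed

text \<open>Minimality leaves no slack in \<open>component_map_cycles\<close>, so distinct blocks lie in distinct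
  components and each factor moves points of a single block only.\<close>

lemma min_fact_split:
  fixes bs :: "'a list list"
  assumes "min_fact K (b # bs) \<tau>"
  shows "\<exists>\<tau>1 \<tau>2. min_fact K [b] \<tau>1 \<and> min_fact K bs \<tau>2 \<and> \<tau> = (\<lambda>l. \<tau>1 l \<circ> \<tau>2 l)
    \<and> (\<forall>l. \<tau>1 l = id \<or> \<tau>2 l = id)"
proof -
  let ?R = "set (concat bs)"
  have dist: "distinct (concat (b # bs))" "distinct (concat bs)" "distinct (concat [b])"
    and ne: "[] \<notin> set (b # bs)" "[] \<notin> set bs" "[] \<notin> set [b]"
    and perm: "\<And>l. \<tau> l permutes set (concat (b # bs))"
    and cyc: "\<And>l. is_cycle (\<tau> l)" and triv: "\<And>l. l \<ge> K \<Longrightarrow> \<tau> l = id"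
    and prod: "ordered_prod \<tau> K = cycles_of_lists (b # bs)"
    and ex: "excess \<tau> K = (\<Sum>b\<leftarrow>b # bs. length b - 1)"
    using assms unfolding min_fact_def by auto
  have disj: "set b \<inter> ?R = {}"
    using dist(1) by simp
  obtain f :: "'a \<Rightarrow> 'a" where f: "\<forall>l<K. \<forall>x y. \<tau> l x \<noteq> x \<longrightarrow> \<tau> l y \<noteq> y \<longrightarrow> f x = f y"
      "\<forall>c\<in>set (b # bs). \<forall>x\<in>set c. f x = f (hd c)"
      "length (concat (b # bs)) \<le> card (f ` set (concat (b # bs))) + excess \<tau> K"
    using component_map_cycles[OF dist(1) perm prod] by blast
  have im: "f ` ?R = set (map (f \<circ> hd) bs)"
    using f(2) by (intro image_blocks ne) (meson list.set_intros(2))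
  \<comment> \<open>Excess equal to the lower bound leaves at least as many names as blocks, so the
    name of \<open>b\<close> differs from every name in \<open>bs\<close>.\<close>
  have "length (b # bs) \<le> card (insert (f (hd b)) (set (map (f \<circ> hd) bs)))"
    using f(3) concat_blocks_length[OF ne(1)] image_blocks[OF ne(1) f(2)] ex by simp
  moreover have "card (set (map (f \<circ> hd) bs)) \<le> length bs"
    using card_length[of "map (f \<circ> hd) bs"] by simp
  ultimately have notin: "f (hd b) \<notin> f ` ?R"
    unfolding im by (auto simp: card_insert_if split: if_splits)
  \<comment> \<open>A factor moving points of \<open>b\<close> and of other blocks would identify
    their names.\<close>
  have single: "{x. \<tau> l x \<noteq> x} \<subseteq> set b \<or> {x. \<tau> l x \<noteq> x} \<subseteq> ?R" for l
  proof (cases "l < K")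
    case True
    show ?thesis
    proof (rule ccontr)
      assume "\<not> ?thesis"
      then obtain x y where xy: "\<tau> l x \<noteq> x" "x \<notin> set b" "\<tau> l y \<noteq> y" "y \<notin> ?R"
        by blast
      then have "x \<in> ?R" "y \<in> set b"
        using permutes_not_in[OF perm[of l], of x] permutes_not_in[OF perm[of l], of y] by auto
      moreover have "f x = f y"
        using f(1) xy True by blast
      ultimately show False
        using notin f(2) by (metis imageI list.set_intros(1))
    qed
  qed (simp add: triv)
  define \<tau>1 where "\<tau>1 l = (if {x. \<tau> l x \<noteq> x} \<subseteq> set b then \<tau> l else id)" for l
  define \<tau>2 where "\<tau>2 l = (if {x. \<tau> l x \<noteq> x} \<subseteq> set b then id else \<tau> l)" for l
  have eq: "\<tau> = (\<lambda>l. \<tau>1 l \<circ> \<tau>2 l)" and one: "\<tau>1 l = id \<or> \<tau>2 l = id" for l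
    by (auto simp: \<tau>1_def \<tau>2_def fun_eq_iff)
  have perm1: "\<tau>1 l permutes set (concat [b])" for l
    unfolding \<tau>1_def using permutes_superset[OF perm[of l], of "set b"] by (auto simp: permutes_id)
  have perm2: "\<tau>2 l permutes ?R" for l
    unfolding \<tau>2_def using permutes_superset[OF perm[of l], of ?R] single[of l]
    by (auto simp: permutes_id)
  have "ordered_prod \<tau>1 K \<circ> ordered_prod \<tau>2 K = cycles_of_lists [b] \<circ> cycles_of_lists bs"
    using prod ordered_prod_comp[of \<tau>1 "set b" \<tau>2 ?R K] perm1 perm2 disj unfolding eq[symmetric]
    by simp
  then have prods: "ordered_prod \<tau>1 K = cycles_of_lists [b] \<and> ordered_prod \<tau>2 K = cycles_of_lists bs"
    using disj perm1 perm2
    by (intro disjoint_permutes_comp_unique[of _ "set (concat [b])" _ ?R] ordered_prod_permutes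
        cycles_of_lists_permutes) auto
  have "excess \<tau> K = excess \<tau>1 K + excess \<tau>2 K"
    unfolding eq by (rule excess_comp) (use one in auto)
  moreover have "(\<Sum>b\<leftarrow>[b]. length b - 1) \<le> excess \<tau>1 K"
    using prods by (intro excess_ge[OF dist(3) ne(3) perm1]) auto
  moreover have "(\<Sum>b\<leftarrow>bs. length b - 1) \<le> excess \<tau>2 K"
    using prods by (intro excess_ge[OF dist(2) ne(2) perm2]) auto
  \<comment> \<open>Both parts satisfy the lower bound and their sum attains it, so each part is
    minimal.\<close>
  ultimately have exs: "excess \<tau>1 K = (\<Sum>b\<leftarrow>[b]. length b - 1)" "excess \<tau>2 K = (\<Sum>b\<leftarrow>bs. length b - 1)"
    using ex by auto
  have "min_fact K [b] \<tau>1" "min_fact K bs \<tau>2"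
    unfolding min_fact_def using prods exs dist ne perm1 perm2 cyc triv
    by (auto simp: \<tau>1_def \<tau>2_def is_cycle_id)
  then show ?thesis
    using eq one by blast
qed

section \<open>Cutting a word before the letters of a given set\<close>

text \<open>These are the pieces, after an initial prefix free of \<open>X\<close>, when a word is
  cut before each letter of \<open>X\<close>. With \<open>X\<close> the points moved by the last
  factor, they are the members of \<open>bs @ [vs]\<close>, and the prefix is
  \<open>us\<close>.\<close>

definition blocks :: "'a set \<Rightarrow> 'a list list \<Rightarrow> bool" where
  "blocks X cs \<longleftrightarrow> (\<forall>c\<in>set cs. c \<noteq> [] \<and> hd c \<in> X \<and> set (tl c) \<inter> X = {})"

lemma blocks_exist:
  "\<exists>us cs. xs = us @ concat cs \<and> set us \<inter> X = {} \<and> blocks X cs"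
proof (induction xs)
  case Nil
  then show ?case by (intro exI[of _ "[]"]) (simp add: blocks_def)
next
  case (Cons x xs)
  then obtain us cs where *: "xs = us @ concat cs" "set us \<inter> X = {}" "blocks X cs"
    by auto
  show ?case
  proof (cases "x \<in> X")
    case True
    with * show ?thesis
      by (intro exI[of _ "[]"] exI[of _ "(x # us) # cs"]) (auto simp: blocks_def)
  next
    case False
    with * show ?thesis
      by (intro exI[of _ "x # us"] exI[of _ cs]) auto
  qed
qed

lemma blocks_takeWhile:
  assumes "set us \<inter> X = {}" "blocks X cs"
  shows "takeWhile (\<lambda>x. x \<notin> X) (us @ concat cs) = us"
proof -
  have "takeWhile (\<lambda>x. x \<notin> X) (concat cs) = []"
  proof (cases cs)
    case (Cons c cs')
    then show ?thesis
      using assms(2) by (cases c) (auto simp: blocks_def)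
  qed simp
  then show ?thesis
    using assms(1) by (simp add: takeWhile_append disjoint_iff)
qed

text \<open>\<open>us\<close> must be the longest prefix avoiding \<open>X\<close>. Once the first
  letter of a block is removed, the tail of that block plays the same part for the rest of the
  word.\<close>

lemma blocks_unique:
  assumes "us @ concat cs = us' @ concat cs'" "set us \<inter> X = {}" "set us' \<inter> X = {}"
    and "blocks X cs" "blocks X cs'"
  shows "us = us' \<and> cs = cs'"
  using assms
proof (induction cs arbitrary: us us' cs')
  case Nil
  have "us = us'"
    using blocks_takeWhile[OF Nil(2,4)] blocks_takeWhile[OF Nil(3,5)] Nil(1) by metis
  moreover have "cs' = []"
    using Nil.prems(1,5) calculation by (cases cs') (auto simp: blocks_def)
  ultimately show ?case by simp
next
  case (Cons c cs)
  have us: "us = us'"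
    using blocks_takeWhile[OF Cons(3,5)] blocks_takeWhile[OF Cons(4,6)] Cons(2) by metis
  then have eq: "concat (c # cs) = concat cs'"
    using Cons.prems by simp
  then obtain c' cs'' where cs': "cs' = c' # cs''"
    using Cons.prems by (cases cs') (auto simp: blocks_def)
  have ne: "c \<noteq> []" "c' \<noteq> []"
    using Cons.prems cs' by (auto simp: blocks_def)
  then have "hd c = hd c'" "tl c @ concat cs = tl c' @ concat cs''"
    using eq cs' by (auto simp: neq_Nil_conv)
  moreover have "tl c = tl c' \<and> cs = cs''"
    by (rule Cons.IH) (use calculation Cons.prems cs' in \<open>auto simp: blocks_def\<close>)
  ultimately show ?case
    using us cs' ne by (metis list.expand)
qed

lemma blocks_heads: "blocks X cs \<Longrightarrow> set (concat cs) \<inter> X = hd ` set cs"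
proof (induction cs)
  case (Cons c cs)
  then have "c = hd c # tl c" "hd c \<in> X" "set (tl c) \<inter> X = {}"
    by (auto simp: blocks_def)
  then have "set c \<inter> X = {hd c}"
    by (metis Int_insert_left_if1 list.simps(15))
  then show ?case
    using Cons by (auto simp: blocks_def)
qed simp

lemma distinct_heads:
  assumes "distinct (concat cs)" "[] \<notin> set cs"
  shows "distinct (map hd cs)"
  using assms
proof (induction cs)
  case (Cons c cs)
  have "hd d \<in> set d" if "d \<in> set (c # cs)" for d
    using that Cons.prems(2) by (intro hd_in_set) auto
  then have "hd c \<in> set c" "hd ` set cs \<subseteq> set (concat cs)"
    by auto
  then have "hd c \<notin> hd ` set cs"
    using Cons.prems(1) by auto
  then show ?case
    using Cons by simp
qed simp

text \<open>Lets a cut given by its pieces be compared, through \<open>blocks_unique\<close>, with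
  any other cut of the word that has the same set of heads.\<close>

lemma blocks_if_heads:
  assumes "distinct (concat cs)" "[] \<notin> set cs" "X = hd ` set cs"
  shows "blocks X cs"
  unfolding blocks_def
proof (intro ballI conjI)
  fix c assume c: "c \<in> set cs"
  then show ne: "c \<noteq> []" and "hd c \<in> X"
    using assms by auto
  have "hd d \<notin> set (tl c)" if d: "d \<in> set cs" for d
  proof (cases "d = c")
    case True
    have "distinct c"
      using assms(1) c by (simp add: distinct_concat_iff)
    then show ?thesis
      using True ne by (cases c) auto
  next
    case False
    then have "set c \<inter> set d = {}" "d \<noteq> []"
      using assms(1,2) c d by (auto simp: distinct_concat_iff)
    then show ?thesis
      by (metis disjoint_iff hd_in_set list.set_sel(2) ne)
  qed
  then show "set (tl c) \<inter> X = {}"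
    using assms(3) by auto
qed

section \<open>Adding and removing the last factor\<close>

text \<open>The cycle through the \<open>length bs + 1\<close> heads has excess
  \<open>length bs\<close>, which is exactly the gain from merging \<open>length bs + 1\<close>
  cycles into one; the product is given by \<open>cycle_of_list_split\<close>.\<close>

lemma min_fact_Suc_join:
  assumes "min_fact N ((us @ vs) # bs) \<tau>" "bs \<noteq> []" "vs \<noteq> []" 
  shows "min_fact (Suc N) [us @ concat bs @ vs] (\<tau>(N := cycle_of_list (map hd bs @ [hd vs])))"
proof -
  let ?xs = "us @ concat bs @ vs" and ?h = "map hd bs @ [hd vs]"
  have dist: "distinct ?xs" and ne: "[] \<notin> set bs" "[] \<notin> set ((us @ vs) # bs)"
    and perm: "\<And>l. \<tau> l permutes set ?xs"
    and cyc: "\<And>l. is_cycle (\<tau> l)" and triv: "\<And>l. l \<ge> N \<Longrightarrow> \<tau> l = id"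
    and prod: "ordered_prod \<tau> N = cycles_of_lists ((us @ vs) # bs)"
    and ex: "excess \<tau> N = (\<Sum>b\<leftarrow>(us @ vs) # bs. length b - 1)"
    using assms unfolding min_fact_def by (auto simp: Un_ac)
  have "hd b \<in> set b" if "b \<in> set bs" for b
    using that ne by (metis list.set_sel(1))
  then have sub: "set ?h \<subseteq> set ?xs"
    using assms(3) by auto
  have dh: "distinct ?h"
    using distinct_heads[of "bs @ [vs]"] dist ne(1) assms(3) by auto
  have "cycle_length (cycle_of_list ?h) = Suc (length bs)"
    using cycle_length_cycle_of_list[OF dh] assms(2) by (cases bs) auto
  then have "excess (\<tau>(N := cycle_of_list ?h)) (Suc N) = excess \<tau> N + length bs"
    by (simp add: excess_def)
  also have "\<dots> = length ?xs - 1"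
    using ex concat_blocks_length[OF ne(1)] assms(3) by (cases vs) auto
  finally have "excess (\<tau>(N := cycle_of_list ?h)) (Suc N) = length ?xs - 1" .
  moreover have "ordered_prod (\<tau>(N := cycle_of_list ?h)) (Suc N) = cycle_of_list ?xs"
    using cycle_of_list_split[OF assms(3) ne(1) dist] prod
      ordered_prod_cong[of N "\<tau>(N := cycle_of_list ?h)" \<tau>] by simp
  moreover have "cycle_of_list ?h permutes set ?xs" "is_cycle (cycle_of_list ?h)"
    using permutes_subset[OF cycle_permutes sub] dh by (auto simp only: is_cycle_def)
  then have "(\<tau>(N := cycle_of_list ?h)) l permutes set ?xs"
    "is_cycle ((\<tau>(N := cycle_of_list ?h)) l)" for l
    using perm[of l] cyc[of l] by (simp_all split: if_split del: set_append cycle_of_list.simps)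
  moreover have "\<forall>l\<ge>Suc N. (\<tau>(N := cycle_of_list ?h)) l = id"
    using triv by simp
  moreover have "concat [?xs] = ?xs" "cycles_of_lists [?xs] = cycle_of_list ?xs" "[] \<notin> set [?xs]"
    using assms(3) by simp_all
  ultimately show ?thesis
    unfolding min_fact_def using dist by simp
qed

text \<open>Cut \<open>xs\<close> before the points moved by \<open>\<tau> N\<close>. At steps that
  do not end at a head, the product \<sigma> of the earlier factors already agrees with the cycles
  on the pieces, so each piece lies in one component of these factors. By the excess count there are
  at least \<open>card X\<close> components, so different heads lie in different components, and
  this forces agreement at the heads as well.\<close>

lemma min_fact_Suc_split:
  fixes xs :: "'a list"
  assumes fact: "min_fact (Suc N) [xs] \<tau>" and nontriv: "\<tau> N \<noteq> id"
  shows "\<exists>us bs vs. xs = us @ concat bs @ vs \<and> bs \<noteq> [] \<and> vs \<noteq> []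
    \<and> \<tau> N = cycle_of_list (map hd bs @ [hd vs])
    \<and> min_fact N ((us @ vs) # bs) (\<tau>(N := id))"
proof -
  have dist: "distinct xs" and xs_ne: "xs \<noteq> []"
    and perm: "\<And>l. \<tau> l permutes set xs"
    and cyc: "\<And>l. is_cycle (\<tau> l)" and triv: "\<And>l. l \<ge> Suc N \<Longrightarrow> \<tau> l = id"
    and prod: "\<tau> N \<circ> ordered_prod \<tau> N = cycle_of_list xs"
    and ex: "excess \<tau> N + (cycle_length (\<tau> N) - 1) = length xs - 1"
    using fact unfolding min_fact_def by (auto simp: excess_def)
  define X where "X = {x. \<tau> N x \<noteq> x}"
  define \<sigma> where "\<sigma> = ordered_prod \<tau> N"
  have X_sub: "X \<subseteq> set xs"
    unfolding X_def using permutes_not_in[OF perm] by blast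
  have sub: "{x. \<tau> l x \<noteq> x} \<subseteq> set xs" for l
    using permutes_not_in[OF perm[of l]] by blast
  have finX: "finite X"
    using X_sub finite_subset by blast
  have X_inv: "\<tau> N x \<in> X \<longleftrightarrow> x \<in> X" for x
    unfolding X_def using inj_eq[OF permutes_inj[OF perm[of N]]] by simp
  obtain x where x: "\<tau> N x \<noteq> x"
    using nontriv by (metis eq_id_iff)
  then have "{x, \<tau> N x} \<subseteq> X"
    using X_inv[of x] by (simp add: X_def)
  then have "card {x, \<tau> N x} \<le> card X"
    by (rule card_mono[OF finX])
  then have cardX: "card X \<ge> 2"
    using x by simp
  obtain us cs where cs: "xs = us @ concat cs" "set us \<inter> X = {}" "blocks X cs"
    using blocks_exist by metis
  have "set xs \<inter> X = hd ` set cs"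
    using cs(2) blocks_heads[OF cs(3)] unfolding cs(1) by auto
  then have heads: "X = hd ` set cs"
    using X_sub by blast
  have "card X \<le> length cs"
    unfolding heads using card_length[of "map hd cs"] by simp
  \<comment> \<open>The last piece \<open>vs\<close> will close up cyclically with the prefix
    \<open>us\<close>; a further piece remains because a nontrivial permutation moves at least two
    points.\<close>
  then have "length cs \<ge> 2"
    using cardX by simp
  then have "cs = butlast cs @ [last cs]" "butlast cs \<noteq> []"
    by (cases cs rule: rev_cases; auto)+
  then obtain bs vs where bs: "cs = bs @ [vs]" "bs \<noteq> []"
    by blast
  have ne: "vs \<noteq> []" "[] \<notin> set bs"
    using cs(3) bs by (auto simp: blocks_def)
  let ?h = "map hd bs @ [hd vs]"
  define H where "H = cycle_of_list ?h"
  define C where "C = cycles_of_lists ((us @ vs) # bs)"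
  have xs: "xs = us @ concat bs @ vs"
    using cs bs by simp
  have HC: "\<tau> N \<circ> \<sigma> = H \<circ> C"
    using prod cycle_of_list_split[OF ne(1,2)] dist unfolding xs H_def C_def \<sigma>_def by simp
  have H_perm: "H permutes X"
    using cycle_permutes[of ?h] heads bs by (simp add: H_def)
  have dist': "distinct (concat ((vs @ us) # bs))"
    using dist xs by auto
  \<comment> \<open>Rotated to \<open>vs @ us\<close>, the wrapped piece also starts with its only
    point of \<open>X\<close>.\<close>
  have C: "C = cycles_of_lists ((vs @ us) # bs)"
  proof -
    have "distinct (us @ vs)"
      using dist xs by auto
    from cycle_of_list_swap[OF this] show ?thesis
      by (simp add: C_def)
  qed
  \<comment> \<open>Both \<open>H\<close> and \<open>\<tau> N\<close> act inside \<open>X\<close>,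
    so neither is visible when the image under \<open>C\<close> lies outside
    \<open>X\<close>.\<close>
  have next_eq: "\<sigma> a = C a" if "C a \<notin> X" for a
  proof -
    have "\<tau> N (\<sigma> a) = C a"
      using fun_cong[OF HC, of a] that permutes_not_in[OF H_perm] by simp
    moreover from this have "\<sigma> a \<notin> X"
      using that X_inv[of "\<sigma> a"] by simp
    ultimately show ?thesis
      by (simp add: X_def)
  qed
  obtain f :: "'a \<Rightarrow> 'a" where f: "\<forall>l<N. \<forall>x\<in>{x. \<tau> l x \<noteq> x}. \<forall>y\<in>{x. \<tau> l x \<noteq> x}. f x = f y"
    "card (set xs) \<le> card (f ` set xs) + (\<Sum>l<N. card {x. \<tau> l x \<noteq> x} - 1)"
    using component_map[of "set xs" N "\<lambda>l. {x. \<tau> l x \<noteq> x}", OF finite_set sub] by blast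
  have \<sigma>_inv: "f (\<sigma> a) = f a" for a
    unfolding \<sigma>_def
    using f(1) by (intro ordered_prod_invariant permutes_inj[OF perm]) blast
  have block: "c \<noteq> []" "hd c \<in> X" "set (tl c) \<inter> X = {}" if "c \<in> set ((vs @ us) # bs)" for c
  proof -
    have "blocks X ((vs @ us) # bs)"
      using cs(2,3) bs(1) ne(1) by (auto simp: blocks_def)
    with that show "c \<noteq> []" "hd c \<in> X" "set (tl c) \<inter> X = {}"
      unfolding blocks_def by blast+
  qed
  have const: "f a = f (hd c)" if c: "c \<in> set ((vs @ us) # bs)" "a \<in> set c" for a c
  proof (rule constant_if_cycle_invariant[OF _ _ c(2)])
    show "distinct c"
      using dist' c(1) by (auto simp: distinct_concat_iff)
    fix a assume a: "a \<in> set c" "cycle_of_list c a \<noteq> hd c"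
    have "C a = cycle_of_list c a"
      unfolding C by (rule cycles_of_lists_apply[OF dist' c(1) a(1)])
    moreover have "cycle_of_list c a \<in> set c"
      using a(1) permutes_in_image[OF cycle_permutes] by fastforce
    ultimately have "C a = cycle_of_list c a" "C a \<notin> X"
      using a(2) block[OF c(1)] by (cases c; auto)+
    then show "f (cycle_of_list c a) = f a"
      using next_eq[of a] \<sigma>_inv[of a] by simp
  qed
  have set_xs: "set xs = set (concat ((vs @ us) # bs))"
    using xs by auto
  have fX: "f ` set xs = f ` X"
  proof
    show "f ` set xs \<subseteq> f ` X"
      using const block(2) unfolding set_xs by fastforce
  qed (use X_sub in auto)
  have "length xs \<ge> 1"
    using xs_ne by (cases xs) auto
  moreover have "card (set xs) = length xs"
    using dist by (rule distinct_card)
  moreover have "cycle_length (\<tau> N) = card X"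
    by (simp add: cycle_length_def X_def)
  \<comment> \<open>The excess \<open>card X - 1\<close> of \<open>\<tau> N\<close> leaves
    \<open>length xs - card X\<close> for the earlier factors, hence at least \<open>card X\<close>
    names.\<close>
  ultimately have "card X \<le> card (f ` X)"
    using f(2) ex cardX fX by (simp add: excess_def cycle_length_def)
  then have inj: "inj_on f X"
    using finX by (intro eq_card_imp_inj_on) (auto intro: le_antisym card_image_le)
  have \<tau>N: "\<tau> N = H"
  proof
    fix z
    show "\<tau> N z = H z"
    proof (cases "z \<in> X")
      case True
      then obtain c where c: "c \<in> set ((vs @ us) # bs)" "hd c = z"
        unfolding heads bs(1) using ne(1) by force
      have "z \<in> set c"
        using c block(1) by force
      \<comment> \<open>\<open>a\<close> is the predecessor of \<open>z\<close> in its piece. Then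
        \<open>\<sigma> a\<close> lies in \<open>X\<close> and has the same name as
        \<open>z\<close>, so it is \<open>z\<close> by injectivity of \<open>f\<close> on
        \<open>X\<close>.\<close>
      then obtain a where a: "a \<in> set c" "cycle_of_list c a = z"
        using cycle_permutes[of c] by (metis permutes_image imageE)
      have Ca: "C a = z"
        using cycles_of_lists_apply[OF dist' c(1) a(1)] a(2) C by simp
      then have \<tau>\<sigma>: "\<tau> N (\<sigma> a) = H z"
        using fun_cong[OF HC, of a] by simp
      then have "\<sigma> a \<in> X"
        using X_inv[of "\<sigma> a"] permutes_in_image[OF H_perm, of z] True by simp
      moreover have "f (\<sigma> a) = f z"
        using \<sigma>_inv const[OF c(1) a(1)] c(2) by simp
      ultimately show ?thesis
        using \<tau>\<sigma> True inj by (metis inj_onD)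
    next
      case False
      then show ?thesis
        using permutes_not_in[OF H_perm] by (auto simp: X_def)
    qed
  qed
  then have \<sigma>C: "\<sigma> = C"
    using HC permutes_inj[OF H_perm] by (auto simp: fun_eq_iff dest: injD)
  have dist_bs: "distinct (concat ((us @ vs) # bs))"
    using dist' by auto
  have "card X = length cs"
  proof -
    have dh: "distinct (map hd cs)"
      using distinct_heads[of cs] dist cs(1) ne bs(1) by auto
    then show ?thesis
      using distinct_card[OF dh] heads by simp
  qed
  then have "excess \<tau> N = (\<Sum>b\<leftarrow>(us @ vs) # bs. length b - 1)"
    using ex \<open>cycle_length (\<tau> N) = card X\<close> concat_blocks_length[OF ne(2)] bs ne(1)
    unfolding xs by (cases vs) auto
  moreover have "excess (\<tau>(N := id)) N = excess \<tau> N"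
    by (simp add: excess_def)
  moreover have "ordered_prod (\<tau>(N := id)) N = \<sigma>"
    unfolding \<sigma>_def by (rule ordered_prod_cong) simp
  moreover have "set (concat ((us @ vs) # bs)) = set xs"
    using xs by auto
  ultimately have "min_fact N ((us @ vs) # bs) (\<tau>(N := id))"
    unfolding min_fact_def using dist_bs ne perm cyc triv \<sigma>C C_def
    by (auto simp: is_cycle_id permutes_id)
  then show ?thesis
    using xs ne bs \<tau>N H_def by blast
qed

section \<open>Inserting the black vertex with the largest label\<close>

lemma decreasing_append:
  "decreasing (xs @ ys) \<longleftrightarrow> decreasing xs \<and> decreasing ys \<and> (\<forall>x\<in>set xs. \<forall>y\<in>set ys. y < x)"
  by (auto simp: decreasing_def sorted_wrt_append)

lemma decreasing_Cons: "decreasing (x # ys) \<longleftrightarrow> decreasing ys \<and> (\<forall>y\<in>set ys. y < x)"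
  by (auto simp: decreasing_def)

text \<open>Undoing the rotation puts \<open>p\<close> back inside a decreasing sequence: the labels
  above \<open>p\<close> precede it there, although they follow \<open>us\<close> around the
  vertex.\<close>

lemma cyclically_decreasing_Cons:
  "cyclically_decreasing (p # xs) \<longleftrightarrow> (\<exists>us vs. xs = us @ vs \<and> decreasing (vs @ p # us))"
proof
  assume "cyclically_decreasing (p # xs)"
  then obtain ys m where ys: "decreasing ys" "p # xs = rotate m ys"
    by (auto simp: cyclically_decreasing_def)
  define k where "k = m mod length ys"
  have eq: "p # xs = drop k ys @ take k ys"
    using ys(2) by (simp add: rotate_drop_take k_def)
  show "\<exists>us vs. xs = us @ vs \<and> decreasing (vs @ p # us)"
  proof (cases "drop k ys")
    case Nil
    then have "ys = p # xs" using eq by (metis append_Nil append_take_drop_id append_Nil2)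
    then show ?thesis using ys(1) by (intro exI[of _ xs] exI[of _ "[]"]) simp
  next
    case (Cons q us)
    then have "q = p" "xs = us @ take k ys" "ys = take k ys @ p # us"
      using eq by (auto, metis append_take_drop_id)
    then show ?thesis using ys(1) by metis
  qed
next
  assume "\<exists>us vs. xs = us @ vs \<and> decreasing (vs @ p # us)"
  then obtain us vs where *: "xs = us @ vs" "decreasing (vs @ p # us)" by auto
  then have "p # xs = rotate (length vs) (vs @ p # us)"
    by (simp add: rotate_append)
  then show "cyclically_decreasing (p # xs)"
    using *(2) unfolding cyclically_decreasing_def by blast
qed

text \<open>Only labels in \<open>us\<close> lie below \<open>p\<close>, so \<open>us\<close> is
  empty. With \<open>p = 0\<close> the condition at the root becomes an instance of the one at other
  white vertices.\<close>

lemma cyclically_decreasing_less: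
  assumes "\<forall>x\<in>set xs. p < x"
  shows "cyclically_decreasing (p # xs) \<longleftrightarrow> decreasing xs"
proof
  assume "cyclically_decreasing (p # xs)"
  then obtain us vs where "xs = us @ vs" "decreasing (vs @ p # us)"
    unfolding cyclically_decreasing_Cons by auto
  moreover from this have "us = []"
    using assms by (cases us) (auto simp: decreasing_append decreasing_Cons)
  ultimately show "decreasing xs" by (auto simp: decreasing_append)
next
  assume "decreasing xs"
  then show "cyclically_decreasing (p # xs)"
    unfolding cyclically_decreasing_Cons using assms
    by (intro exI[of _ "[]"] exI[of _ xs]) (auto simp: decreasing_append decreasing_Cons decreasing_def[of "[]"])
qed

text \<open>Here \<open>vs\<close> is empty. A parent with the largest label thus imposes the same
  order as a virtual parent 0.\<close>

lemma cyclically_decreasing_greater: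
  assumes "\<forall>x\<in>set xs. x < p"
  shows "cyclically_decreasing (p # xs) \<longleftrightarrow> decreasing xs"
proof
  assume "cyclically_decreasing (p # xs)"
  then obtain us vs where "xs = us @ vs" "decreasing (vs @ p # us)"
    unfolding cyclically_decreasing_Cons by auto
  moreover from this have "vs = []"
    using assms by (cases vs) (auto simp: decreasing_append decreasing_Cons)
  ultimately show "decreasing xs" by (auto simp: decreasing_append decreasing_Cons)
next
  assume "decreasing xs"
  then show "cyclically_decreasing (p # xs)"
    unfolding cyclically_decreasing_Cons using assms
    by (intro exI[of _ xs] exI[of _ "[]"]) (auto simp: decreasing_Cons)
qed

text \<open>The position between \<open>us\<close> and \<open>vs\<close> is the corner of the white vertex at which the labels
  wrap around; a new largest label can be inserted only there.\<close>

lemma cyclically_decreasing_insert_max: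
  assumes "p < N" "\<forall>x\<in>set (us @ vs). x < N"
  shows "cyclically_decreasing (p # us @ N # vs) \<longleftrightarrow> decreasing (vs @ p # us)"
proof
  assume "cyclically_decreasing (p # us @ N # vs)"
  then obtain us' vs' where *: "us @ N # vs = us' @ vs'" "decreasing (vs' @ p # us')"
    unfolding cyclically_decreasing_Cons by auto
  have "N \<in> set us' \<union> set vs'"
    using arg_cong[OF *(1), of set] by auto
  moreover have "N \<notin> set us'"
    using *(2) assms(1) by (auto simp: decreasing_append decreasing_Cons)
  ultimately obtain as bs where vs': "vs' = as @ N # bs"
    by (auto dest: split_list)
  have "N < a" if "a \<in> set as" for a
    using *(2) that unfolding vs' by (auto simp: decreasing_append decreasing_Cons)
  moreover have "set vs' \<subseteq> {..N}"
    using assms(2) arg_cong[OF *(1), of set] by (auto simp: less_imp_le)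
  \<comment> \<open>An entry before \<open>N\<close> in the decreasing \<open>vs'\<close> would
    exceed the maximum.\<close>
  ultimately have "as = []"
    unfolding vs' by (cases as) fastforce+
  have eq: "us @ N # vs = us' @ N # bs"
    using *(1) vs' \<open>as = []\<close> by simp
  have "N \<notin> set us" "N \<notin> set us'"
    using assms(2) \<open>N \<notin> set us'\<close> by auto
  then have "us = us' \<and> vs = bs"
    using eq by (auto simp: append_eq_append_conv2 append_eq_Cons_conv Cons_eq_append_conv)
  then show "decreasing (vs @ p # us)"
    using *(2) vs' \<open>as = []\<close> by (simp add: decreasing_Cons)
next
  assume "decreasing (vs @ p # us)"
  then have "decreasing ((N # vs) @ p # us)"
    using assms by (auto simp: decreasing_Cons)
  then show "cyclically_decreasing (p # us @ N # vs)"
    unfolding cyclically_decreasing_Cons by blast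
qed

section \<open>Listing the insertions of a black vertex\<close>

text \<open>Lists are used instead of sets because insertions will be counted and addressed by
  index.\<close>

fun modify_one :: "('a \<Rightarrow> 'a list) \<Rightarrow> 'a list \<Rightarrow> 'a list list" where
  "modify_one F [] = []"
| "modify_one F (y # ys) = map (\<lambda>y'. y' # ys) (F y) @ map ((#) y) (modify_one F ys)"

text \<open>The congruence rule tells the function package that the recursive calls made through
  \<open>modify_one\<close> concern only children.\<close>

lemma modify_one_cong [fundef_cong]:
  "ys = ys' \<Longrightarrow> (\<And>y. y \<in> set ys' \<Longrightarrow> F y = G y) \<Longrightarrow> modify_one F ys = modify_one G ys'"
  by (induction ys arbitrary: ys') auto

lemma set_modify_one:
  "zs \<in> set (modify_one F ys) \<longleftrightarrow> (\<exists>as y bs y'. ys = as @ y # bs \<and> zs = as @ y' # bs \<and> y' \<in> set (F y))"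
proof (induction ys arbitrary: zs)
  case (Cons x ys)
  show ?case
  proof
    assume "zs \<in> set (modify_one F (x # ys))"
    then consider x' where "x' \<in> set (F x)" "zs = x' # ys"
      | zs' where "zs' \<in> set (modify_one F ys)" "zs = x # zs'"
      by auto
    then show "\<exists>as y bs y'. x # ys = as @ y # bs \<and> zs = as @ y' # bs \<and> y' \<in> set (F y)"
    proof cases
      case 1
      then show ?thesis by (intro exI[of _ "[]"]) auto
    next
      case 2
      then show ?thesis unfolding Cons.IH by (metis append_Cons)
    qed
  next
    assume "\<exists>as y bs y'. x # ys = as @ y # bs \<and> zs = as @ y' # bs \<and> y' \<in> set (F y)"
    then obtain as y bs y' where *: "x # ys = as @ y # bs" "zs = as @ y' # bs" "y' \<in> set (F y)"
      by blast
    show "zs \<in> set (modify_one F (x # ys))"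
    proof (cases as)
      case Nil
      then show ?thesis using * by auto
    next
      case (Cons a as')
      with * have "as' @ y' # bs \<in> set (modify_one F ys)"
        using Cons.IH by auto
      then show ?thesis using * Cons by auto
    qed
  qed
qed simp

lemma length_modify_one: "length (modify_one F ys) = (\<Sum>y\<leftarrow>ys. length (F y))"
  by (induction ys) auto

text \<open>Lists changed at different positions differ because no entry is replaced by
  itself.\<close>

lemma distinct_modify_one:
  assumes "\<And>y. y \<in> set ys \<Longrightarrow> distinct (F y)" "\<And>y. y \<in> set ys \<Longrightarrow> y \<notin> set (F y)"
  shows "distinct (modify_one F ys)"
  using assms by (induction ys) (auto simp: distinct_map inj_on_def)

text \<open>\<open>insertions_w p x t\<close> lists, one entry for each white vertex of \<open>t\<close>, the results of adding \<open>x\<close>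
  below that vertex at its wrap-around corner; \<open>p\<close> is the label of the parent of \<open>t\<close>, and \<open>p = 0\<close>
  serves at the root.\<close>

fun insertions_w :: "nat \<Rightarrow> black_tree \<Rightarrow> white_tree \<Rightarrow> white_tree list"
  and insertions_b :: "black_tree \<Rightarrow> black_tree \<Rightarrow> black_tree list" where
  "insertions_w p x (White bs) =
     White (takeWhile (\<lambda>b. label b < p) bs @ x # dropWhile (\<lambda>b. label b < p) bs)
     # map White (modify_one (insertions_b x) bs)"
| "insertions_b x (Black l ws) = map (Black l) (modify_one (insertions_w l x) ws)"


text \<open>The case \<open>here\<close> forgets which corner was chosen: labels, sizes, leaves and
  the inverse operations do not depend on it. Only the sorting condition does.\<close>

lemma insertions_w_cases:
  assumes "t' \<in> set (insertions_w p x (White bs))"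
  obtains (here) as cs where "bs = as @ cs" "t' = White (as @ x # cs)"
  | (below) as b cs b' where "bs = as @ b # cs" "t' = White (as @ b' # cs)" "b' \<in> set (insertions_b x b)"
proof -
  consider "t' = White (takeWhile (\<lambda>b. label b < p) bs @ x # dropWhile (\<lambda>b. label b < p) bs)"
    | bs' where "t' = White bs'" "bs' \<in> set (modify_one (insertions_b x) bs)"
    using assms by auto
  then show thesis
  proof cases
    case 1
    then show thesis
      by (rule here[OF takeWhile_dropWhile_id[symmetric]])
  next
    case 2
    then show thesis
      using below unfolding set_modify_one by blast
  qed
qed

lemma insertions_b_cases:
  assumes "b' \<in> set (insertions_b x (Black l ws))"
  obtains as w cs w' where "ws = as @ w # cs" "b' = Black l (as @ w' # cs)"
    "w' \<in> set (insertions_w l x w)"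
proof -
  obtain ws' where "b' = Black l ws'" "ws' \<in> set (modify_one (insertions_w l x) ws)"
    using assms by auto
  then show thesis
    using that unfolding set_modify_one by blast
qed

lemma insertions_w_below:
  assumes "b' \<in> set (insertions_b x b)"
  shows "White (as @ b' # cs) \<in> set (insertions_w p x (White (as @ b # cs)))"
proof -
  have "as @ b' # cs \<in> set (modify_one (insertions_b x) (as @ b # cs))"
    unfolding set_modify_one using assms by blast
  then show ?thesis by simp
qed

lemma insertions_b_below:
  assumes "w' \<in> set (insertions_w l x w)"
  shows "Black l (as @ w' # cs) \<in> set (insertions_b x (Black l (as @ w # cs)))"
proof -
  have "as @ w' # cs \<in> set (modify_one (insertions_w l x) (as @ w # cs))"
    unfolding set_modify_one using assms by blast
  then show ?thesis by simp
qed

text \<open>One entry for the vertex itself plus those of its children is the recursion of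
  \<open>num_white\<close>. A number below \<open>num_white t\<close> therefore names a white
  vertex.\<close>

lemma length_insertions:
  "length (insertions_w p x t) = num_white t"
  "length (insertions_b x b) = num_white_b b"
  by (induction p x t and x b rule: insertions_w_insertions_b.induct)
    (auto simp: length_modify_one cong: map_cong)

lemma label_insertions_b: "b' \<in> set (insertions_b x b) \<Longrightarrow> label b' = label b"
  by (cases b) auto

text \<open>Multisets forget where the new labels land in the traversal, and still give the set, the
  number and the distinctness of the labels.\<close>

lemma mset_black_labels_insertions:
  "t' \<in> set (insertions_w p x t) \<Longrightarrow>
    mset (black_labels t') = mset (black_labels_b x) + mset (black_labels t)"
  "b' \<in> set (insertions_b x b) \<Longrightarrow>
    mset (black_labels_b b') = mset (black_labels_b x) + mset (black_labels_b b)"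
proof (induction p x t and x b arbitrary: t' and b' rule: insertions_w_insertions_b.induct)
  case (1 p x bs)
  from "1.prems"(1) show ?case
  proof (cases rule: insertions_w_cases)
    case (here as cs)
    then show ?thesis
      by simp
  next
    case (below as b cs b')
    then show ?thesis
      using "1.IH"[of b b'] by simp
  qed
next
  case (2 x l ws)
  from "2.prems"(1) obtain as w cs w' where "ws = as @ w # cs" "b' = Black l (as @ w' # cs)"
    "w' \<in> set (insertions_w l x w)"
    by (rule insertions_b_cases)
  then show ?case
    using "2.IH"[of w w'] by simp
qed

lemma num_white_insertions:
  "t' \<in> set (insertions_w p x t) \<Longrightarrow> num_white t' = num_white_b x + num_white t"
  "b' \<in> set (insertions_b x b) \<Longrightarrow> num_white_b b' = num_white_b x + num_white_b b"
proof (induction p x t and x b arbitrary: t' and b' rule: insertions_w_insertions_b.induct)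
  case (1 p x bs)
  from "1.prems"(1) show ?case
  proof (cases rule: insertions_w_cases)
    case (here as cs)
    then show ?thesis
      by simp
  next
    case (below as b cs b')
    then show ?thesis
      using "1.IH"[of b b'] by simp
  qed
next
  case (2 x l ws)
  from "2.prems"(1) obtain as w cs w' where "ws = as @ w # cs" "b' = Black l (as @ w' # cs)"
    "w' \<in> set (insertions_w l x w)"
    by (rule insertions_b_cases)
  then show ?case
    using "2.IH"[of w w'] by simp
qed

lemma leaves_white_insertions:
  "t' \<in> set (insertions_w p x t) \<Longrightarrow> leaves_white_b x \<Longrightarrow> leaves_white t \<Longrightarrow> leaves_white t'"
  "b' \<in> set (insertions_b x b) \<Longrightarrow> leaves_white_b x \<Longrightarrow> leaves_white_b b \<Longrightarrow> leaves_white_b b'"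
proof (induction p x t and x b arbitrary: t' and b' rule: insertions_w_insertions_b.induct)
  case (1 p x bs)
  from "1.prems"(1) show ?case
  proof (cases rule: insertions_w_cases)
    case (here as cs)
    then show ?thesis
      using "1.prems" by auto
  next
    case (below as b cs b')
    then show ?thesis
      using "1.IH"[of b b'] "1.prems" by auto
  qed
next
  case (2 x l ws)
  from "2.prems"(1) obtain as w cs w' where "ws = as @ w # cs" "b' = Black l (as @ w' # cs)"
    "w' \<in> set (insertions_w l x w)"
    by (rule insertions_b_cases)
  then show ?case
    using "2.IH"[of w w'] "2.prems"(2,3) by auto
qed

lemma black_labels_b_ne: "black_labels_b b \<noteq> []"
  by (cases b) simp

text \<open>Insertion adds labels, so no tree is an insertion into itself and
  \<open>distinct_modify_one\<close> applies. Insertion at a vertex gives it one more child, whereas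
  insertion further down keeps the number of its children.\<close>

lemma distinct_insertions:
  "distinct (insertions_w p x t)"
  "distinct (insertions_b x b)"
proof (induction p x t and x b rule: insertions_w_insertions_b.induct)
  case (1 p x bs)
  have "b \<notin> set (insertions_b x b)" for b
    using mset_black_labels_insertions(2)[of b x b] black_labels_b_ne[of x] by auto
  then have "distinct (modify_one (insertions_b x) bs)"
    using 1 by (intro distinct_modify_one)
  moreover have "length bs' = length bs" if "bs' \<in> set (modify_one (insertions_b x) bs)" for bs'
    using that by (auto simp: set_modify_one)
  moreover have "length (takeWhile (\<lambda>b. label b < p) bs @ x # dropWhile (\<lambda>b. label b < p) bs) = Suc (length bs)"
    by (metis add_Suc_right length_Cons length_append takeWhile_dropWhile_id)
  ultimately show ?case
    by (fastforce simp: distinct_map inj_on_def)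
next
  case (2 x l ws)
  have "w \<notin> set (insertions_w l x w)" for w
    using mset_black_labels_insertions(1)[of w l x w] black_labels_b_ne[of x] by auto
  then have "distinct (modify_one (insertions_w l x) ws)"
    using 2 by (intro distinct_modify_one)
  then show ?case
    by (simp add: distinct_map inj_on_def)
qed

lemma label_in_black_labels: "label b \<in> set (black_labels_b b)"
  by (cases b) simp

text \<open>At the wrap-around corner a label above all others fits the cyclic order. Insertion
  further down keeps the labels of the children, so the order at the vertices above does not
  change.\<close>

lemma sorted_insertions:
  "t' \<in> set (insertions_w p x t) \<Longrightarrow> sorted_white p t \<Longrightarrow> sorted_black x \<Longrightarrow> p < label x \<Longrightarrow>
    \<forall>l\<in>set (black_labels t). l < label x \<Longrightarrow> sorted_white p t'"
  "b' \<in> set (insertions_b x b) \<Longrightarrow> sorted_black b \<Longrightarrow> sorted_black x \<Longrightarrow>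
    \<forall>l\<in>set (black_labels_b b). l < label x \<Longrightarrow> sorted_black b'"
proof (induction p x t and x b arbitrary: t' and b' rule: insertions_w_insertions_b.induct)
  case (1 p x bs)
  have less: "label b < label x" if "b \<in> set bs" for b
    using that "1.prems"(5) label_in_black_labels[of b] by auto
  consider "t' = White (takeWhile (\<lambda>b. label b < p) bs @ x # dropWhile (\<lambda>b. label b < p) bs)"
    | as b cs b' where "bs = as @ b # cs" "t' = White (as @ b' # cs)" "b' \<in> set (insertions_b x b)"
    using "1.prems"(1) by (auto simp: set_modify_one)
  then show ?case
  proof cases
    case 1
    obtain us vs where uv: "map label bs = us @ vs" "decreasing (vs @ p # us)"
      using "1.prems"(2) by (auto simp: cyclically_decreasing_Cons)
    obtain as cs where bs: "bs = as @ cs" "map label as = us" "map label cs = vs"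
      using uv(1) by (auto simp: map_eq_append_conv)
    \<comment> \<open>In the decreasing sequence \<open>vs @ p # us\<close> the labels below
      \<open>p\<close> are those of \<open>as\<close>, so the scan stops exactly at the
      corner.\<close>
    have "takeWhile (\<lambda>b. label b < p) bs = as \<and> dropWhile (\<lambda>b. label b < p) bs = cs"
    proof -
      have "\<forall>b\<in>set as. label b < p" "\<forall>b\<in>set cs. p < label b"
        using uv(2) bs(2,3) by (auto simp: decreasing_append decreasing_Cons)
      then have "takeWhile (\<lambda>b. label b < p) cs = []" "dropWhile (\<lambda>b. label b < p) cs = cs"
        "\<forall>b\<in>set as. label b < p"
        by (cases cs; auto)+
      then show ?thesis
        unfolding bs(1) by (simp add: takeWhile_append2 dropWhile_append2)
    qed
    moreover have "cyclically_decreasing (p # us @ label x # vs)"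
      using less bs uv(2) "1.prems"(4) by (subst cyclically_decreasing_insert_max) auto
    ultimately show ?thesis
      using 1 bs "1.prems"(2,3) by auto
  next
    case 2
    then show ?thesis
      using "1.IH"[of b b'] "1.prems"(2-5) label_insertions_b[OF 2(3)] by auto
  qed
next
  case (2 x l ws)
  from "2.prems"(1) obtain as w cs w' where "ws = as @ w # cs" "b' = Black l (as @ w' # cs)"
    "w' \<in> set (insertions_w l x w)"
    by (rule insertions_b_cases)
  then show ?case
    using "2.IH"[of w w'] "2.prems"(2-4) by auto
qed

section \<open>Undoing an insertion\<close>

text \<open>Recovers the original tree from the result of an insertion, as \<open>find_w\<close>
  recovers the inserted subtree; together they make the decomposition of a tree unique.\<close>

fun remove_w :: "nat \<Rightarrow> white_tree \<Rightarrow> white_tree" and remove_b :: "nat \<Rightarrow> black_tree \<Rightarrow> black_tree" where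
  "remove_w N (White bs) = White (map (remove_b N) (filter (\<lambda>b. label b \<noteq> N) bs))"
| "remove_b N (Black l ws) = Black l (map (remove_w N) ws)"

fun find_w :: "nat \<Rightarrow> white_tree \<Rightarrow> black_tree list" and find_b :: "nat \<Rightarrow> black_tree \<Rightarrow> black_tree list" where
  "find_w N (White bs) = concat (map (find_b N) bs)"
| "find_b N (Black l ws) = (if l = N then [Black l ws] else concat (map (find_w N) ws))"

lemma remove_not_in:
  "N \<notin> set (black_labels t) \<Longrightarrow> remove_w N t = t"
  "N \<notin> set (black_labels_b b) \<Longrightarrow> remove_b N b = b"
proof (induction N t and N b rule: remove_w_remove_b.induct)
  case (1 N bs)
  have "label b \<noteq> N" if "b \<in> set bs" for b
    using that 1(2) label_in_black_labels[of b] by auto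
  then have "filter (\<lambda>b. label b \<noteq> N) bs = bs"
    by (simp add: filter_id_conv)
  then show ?case
    using 1 by (auto intro: map_idI)
qed (auto intro: map_idI)

lemma find_not_in:
  "N \<notin> set (black_labels t) \<Longrightarrow> find_w N t = []"
  "N \<notin> set (black_labels_b b) \<Longrightarrow> find_b N b = []"
  by (induction N t and N b rule: find_w_find_b.induct) auto

lemma remove_insertions:
  "t' \<in> set (insertions_w p x t) \<Longrightarrow> label x \<notin> set (black_labels t) \<Longrightarrow> remove_w (label x) t' = t"
  "b' \<in> set (insertions_b x b) \<Longrightarrow> label x \<notin> set (black_labels_b b) \<Longrightarrow> remove_b (label x) b' = b"
proof (induction p x t and x b arbitrary: t' and b' rule: insertions_w_insertions_b.induct)
  case (1 p x bs)
  from "1.prems"(1) show ?case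
  proof (cases rule: insertions_w_cases)
    case (here as cs)
    then have "remove_w (label x) t' = remove_w (label x) (White bs)"
      by simp
    then show ?thesis
      using remove_not_in(1)[OF "1.prems"(2)] by simp
  next
    case (below as b cs b')
    have "remove_w (label x) t' = White (map (remove_b (label x)) as' @ b # map (remove_b (label x)) cs')"
      if "as' = filter (\<lambda>b. label b \<noteq> label x) as" "cs' = filter (\<lambda>b. label b \<noteq> label x) cs" for as' cs'
      using that below "1.IH"[of b b'] "1.prems"(2) label_insertions_b[OF below(3)] label_in_black_labels[of b]
      by auto
    \<comment> \<open>Wrapping \<open>as\<close> and \<open>cs\<close> in white vertices lets
      \<open>remove_not_in\<close> act on whole lists of children.\<close>
    moreover have "remove_w (label x) (White as) = White as" "remove_w (label x) (White cs) = White cs"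
      using "1.prems"(2) below(1) by (auto simp del: remove_w.simps intro!: remove_not_in)
    ultimately show ?thesis
      using below(1) by simp
  qed
next
  case (2 x l ws)
  from "2.prems"(1) obtain as w cs w' where "ws = as @ w # cs" "b' = Black l (as @ w' # cs)"
    "w' \<in> set (insertions_w l x w)"
    by (rule insertions_b_cases)
  then show ?case
    using "2.IH"[of w w'] "2.prems"(2) by (auto intro!: map_idI remove_not_in)
qed

lemma concat_map_single:
  assumes "\<And>y. y \<in> set as \<union> set cs \<Longrightarrow> F y = []"
  shows "concat (map F (as @ b # cs)) = F b"
proof -
  have "concat (map F as) = []" "concat (map F cs) = []"
    using assms by auto
  then show ?thesis
    by (simp del: concat_eq_Nil_conv)
qed

lemma find_insertions:
  "t' \<in> set (insertions_w p x t) \<Longrightarrow> label x \<notin> set (black_labels t) \<Longrightarrow> find_w (label x) t' = [x]"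
  "b' \<in> set (insertions_b x b) \<Longrightarrow> label x \<notin> set (black_labels_b b) \<Longrightarrow> find_b (label x) b' = [x]"
proof (induction p x t and x b arbitrary: t' and b' rule: insertions_w_insertions_b.induct)
  case (1 p x bs)
  have none: "find_b (label x) b = []" if "b \<in> set bs" for b
    using that "1.prems"(2) by (auto intro!: find_not_in)
  from "1.prems"(1) show ?case
  proof (cases rule: insertions_w_cases)
    case (here as cs)
    have "find_b (label x) x = [x]"
      by (cases x) simp
    then show ?thesis
      unfolding here(2) find_w.simps using here(1) none by (subst concat_map_single) auto
  next
    case (below as b cs b')
    then have "find_b (label x) b' = [x]"
      using "1.IH"[of b b'] "1.prems"(2) by auto
    then show ?thesis
      unfolding below(2) find_w.simps using below(1) none by (subst concat_map_single) auto
  qed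
next
  case (2 x l ws)
  have none: "find_w (label x) w = []" if "w \<in> set ws" for w
    using that "2.prems"(2) by (auto intro!: find_not_in)
  from "2.prems"(1) obtain as w cs w' where *: "ws = as @ w # cs" "b' = Black l (as @ w' # cs)"
    "w' \<in> set (insertions_w l x w)"
    by (rule insertions_b_cases)
  then have "find_w (label x) w' = [x]"
    using "2.IH"[of w w'] "2.prems"(2) by auto
  then have "concat (map (find_w (label x)) (as @ w' # cs)) = [x]"
    using *(1) none by (subst concat_map_single) auto
  then show ?case
    using *(2) "2.prems"(2) by simp
qed

text \<open>Descend to the vertex labelled \<open>N\<close>. By maximality it sits at the
  wrap-around corner of its parent, so the tree is one of the listed insertions. A black root
  labelled \<open>N\<close> is excluded in the second part because it is handled at its white
  parent.\<close>

lemma insertions_exist: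
  "sorted_white p t \<Longrightarrow> leaves_white t \<Longrightarrow> distinct (black_labels t) \<Longrightarrow> N \<in> set (black_labels t) \<Longrightarrow>
    \<forall>l\<in>set (black_labels t). l \<le> N \<Longrightarrow> p < N \<Longrightarrow>
    \<exists>t0 x. label x = N \<and> t \<in> set (insertions_w p x t0) \<and> sorted_white p t0 \<and> leaves_white t0
      \<and> sorted_black x \<and> leaves_white_b x"
  "sorted_black b \<Longrightarrow> leaves_white_b b \<Longrightarrow> distinct (black_labels_b b) \<Longrightarrow> N \<in> set (black_labels_b b) \<Longrightarrow>
    \<forall>l\<in>set (black_labels_b b). l \<le> N \<Longrightarrow> label b \<noteq> N \<Longrightarrow>
    \<exists>b0 x. label x = N \<and> b \<in> set (insertions_b x b0) \<and> sorted_black b0 \<and> leaves_white_b b0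
      \<and> sorted_black x \<and> leaves_white_b x"
proof (induction p t and b rule: sorted_white_sorted_black.induct)
  case (1 p bs)
  then obtain b where b: "b \<in> set bs" "N \<in> set (black_labels_b b)"
    by auto
  then obtain as cs where bs: "bs = as @ b # cs"
    by (auto dest: split_list)
  have other: "N \<notin> set (black_labels_b d)" if "d \<in> set as \<union> set cs" for d
    using "1.prems"(3) b(2) that unfolding bs by auto
  have less: "label d < N" if "d \<in> set as \<union> set cs" for d
    using "1.prems"(5) that other[OF that] label_in_black_labels[of d] unfolding bs
    by (force simp: le_less)
  show ?case
  proof (cases "label b = N")
    case True
    have dec: "decreasing (map label cs @ p # map label as)"
      using cyclically_decreasing_insert_max[of p N "map label as" "map label cs"] "1.prems"(1,6) less True bs
      by auto
    then have "\<forall>d\<in>set as. label d < p" "\<forall>d\<in>set cs. p < label d"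
      by (auto simp: decreasing_append decreasing_Cons)
    then have "takeWhile (\<lambda>b. label b < p) cs = []" "dropWhile (\<lambda>b. label b < p) cs = cs"
      "\<forall>d\<in>set as. label d < p"
      by (cases cs; auto)+
    then have "White bs \<in> set (insertions_w p b (White (as @ cs)))"
      unfolding bs by (simp add: takeWhile_append2 dropWhile_append2)
    moreover have "sorted_white p (White (as @ cs))"
      using dec "1.prems"(1) bs by (auto simp: cyclically_decreasing_Cons)
    ultimately show ?thesis
      using True "1.prems"(1,2) b(1) bs by (intro exI[of _ "White (as @ cs)"] exI[of _ b]) auto
  next
    case False
    have "\<exists>b0 x. label x = N \<and> b \<in> set (insertions_b x b0) \<and> sorted_black b0 \<and> leaves_white_b b0
      \<and> sorted_black x \<and> leaves_white_b x"
      by (rule "1.IH"[OF b(1)]) (use "1.prems" b bs False in auto)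
    then obtain b0 x where *: "label x = N" "b \<in> set (insertions_b x b0)" "sorted_black b0"
      "leaves_white_b b0" "sorted_black x" "leaves_white_b x"
      by blast
    have "White bs \<in> set (insertions_w p x (White (as @ b0 # cs)))"
      unfolding bs using *(2) by (rule insertions_w_below)
    moreover have "sorted_white p (White (as @ b0 # cs))"
      using "1.prems"(1) bs *(3) label_insertions_b[OF *(2)] by auto
    moreover have "leaves_white (White (as @ b0 # cs))"
      using "1.prems"(2) bs *(4) by auto
    ultimately show ?thesis
      using * by blast
  qed
next
  case (2 l ws)
  then obtain w where w: "w \<in> set ws" "N \<in> set (black_labels w)"
    by auto
  then obtain as cs where ws: "ws = as @ w # cs"
    by (auto dest: split_list)
  have "\<exists>t0 x. label x = N \<and> w \<in> set (insertions_w l x t0) \<and> sorted_white l t0 \<and> leaves_white t0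
      \<and> sorted_black x \<and> leaves_white_b x"
    by (rule "2.IH"[OF w(1)]) (use "2.prems" w ws in \<open>auto simp: le_less\<close>)
  then obtain t0 x where *: "label x = N" "w \<in> set (insertions_w l x t0)" "sorted_white l t0"
      "leaves_white t0" "sorted_black x" "leaves_white_b x"
    by blast
  have "Black l ws \<in> set (insertions_b x (Black l (as @ t0 # cs)))"
    unfolding ws using *(2) by (rule insertions_b_below)
  moreover have "sorted_black (Black l (as @ t0 # cs))" "leaves_white_b (Black l (as @ t0 # cs))"
    using "2.prems"(1,2) ws *(3,4) by auto
  ultimately show ?case
    using * by blast
qed

section \<open>The correspondence\<close>

text \<open>Subtrees inherit arbitrary sets of labels, so no interval is prescribed; 0 is reserved
  for the virtual parent of the root.\<close>

definition valid_tree :: "white_tree \<Rightarrow> bool" where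
  "valid_tree t \<longleftrightarrow>
     leaves_white t \<and> distinct (black_labels t) \<and> 0 \<notin> set (black_labels t) \<and> sorted_white 0 t"

text \<open>Both parent labels reduce the condition at the top vertex to plain decrease. With
  \<open>p = 0\<close> and \<open>q = N\<close> it turns the trees below \<open>N\<close> into
  rooted trees and back.\<close>

lemma sorted_white_change_parent:
  assumes "\<forall>l\<in>set (black_labels t). p < l \<and> l < q"
  shows "sorted_white p t \<longleftrightarrow> sorted_white q t"
proof (cases t)
  case (White bs)
  have "p < label b \<and> label b < q" if "b \<in> set bs" for b
    using assms that label_in_black_labels[of b] White by auto
  then show ?thesis
    using cyclically_decreasing_less[of "map label bs" p] cyclically_decreasing_greater[of "map label bs" q]
    by (auto simp: White)
qed

lemma black_labels_insertion:
  assumes "t \<in> set (insertions_w p (Black N ts) t0)"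
  shows "set (black_labels t) = insert N (set (black_labels t0) \<union> set (concat (map black_labels ts)))"
    and "length (black_labels t) = Suc (length (black_labels t0) + length (concat (map black_labels ts)))"
    and "distinct (black_labels t) \<longleftrightarrow> distinct (N # black_labels t0 @ concat (map black_labels ts))"
proof -
  have eq: "mset (black_labels t) = mset (N # black_labels t0 @ concat (map black_labels ts))"
    using mset_black_labels_insertions(1)[OF assms] by (simp add: ac_simps)
  show "set (black_labels t) = insert N (set (black_labels t0) \<union> set (concat (map black_labels ts)))"
    using mset_eq_setD[OF eq] by simp
  show "length (black_labels t) = Suc (length (black_labels t0) + length (concat (map black_labels ts)))"
    using mset_eq_length[OF eq] by simp
  show "distinct (black_labels t) \<longleftrightarrow> distinct (N # black_labels t0 @ concat (map black_labels ts))"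
    using mset_eq_imp_distinct_iff[OF eq] .
qed

lemma valid_tree_insertion:
  assumes "valid_tree t0" "\<forall>w\<in>set ts. valid_tree w" "ts \<noteq> []" "0 < N"
    and "distinct (N # black_labels t0 @ concat (map black_labels ts))"
    and "\<forall>l\<in>set (black_labels t0 @ concat (map black_labels ts)). l < N"
    and "t \<in> set (insertions_w 0 (Black N ts) t0)"
  shows "valid_tree t"
proof -
  have "sorted_white N w" if w: "w \<in> set ts" for w
  proof -
    have "valid_tree w"
      using assms(2) w by blast
    moreover from this have "\<forall>l\<in>set (black_labels w). 0 < l \<and> l < N"
      using assms(6) w by (auto simp: valid_tree_def intro: gr0I)
    ultimately show ?thesis
      using sorted_white_change_parent[of w 0 N] by (simp add: valid_tree_def)
  qed
  then have "sorted_white 0 t"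
    using assms by (intro sorted_insertions(1)[OF assms(7)]) (auto simp: valid_tree_def)
  moreover have "leaves_white t"
    using assms by (intro leaves_white_insertions(1)[OF assms(7)]) (auto simp: valid_tree_def)
  moreover have "0 \<notin> set (black_labels t)"
    using assms(1,2,4) unfolding black_labels_insertion(1)[OF assms(7)]
    by (auto simp: valid_tree_def)
  ultimately show ?thesis
    using assms(5) black_labels_insertion(3)[OF assms(7)] by (simp add: valid_tree_def)
qed

lemma valid_tree_decompose:
  assumes "valid_tree t" "N = Max (set (black_labels t))" "black_labels t \<noteq> []"
  obtains t0 ts where "t \<in> set (insertions_w 0 (Black N ts) t0)" "ts \<noteq> []" "0 < N"
    and "distinct (N # black_labels t0 @ concat (map black_labels ts))"
    and "\<forall>l\<in>set (black_labels t0 @ concat (map black_labels ts)). l < N"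
    and "valid_tree t0" "\<forall>w\<in>set ts. valid_tree w"
proof -
  have N: "N \<in> set (black_labels t)" and le: "\<forall>l\<in>set (black_labels t). l \<le> N"
    using assms(2,3) by (auto intro: Max_in)
  then have pos: "0 < N"
    using assms(1) by (auto simp: valid_tree_def intro: gr0I)
  then obtain t0 x where *: "label x = N" "t \<in> set (insertions_w 0 x t0)" "sorted_white 0 t0"
      "leaves_white t0" "sorted_black x" "leaves_white_b x"
    using insertions_exist(1)[of 0 t N] N le assms(1) by (auto simp: valid_tree_def)
  obtain ts where x: "x = Black N ts"
    using *(1) by (cases x) auto
  note ins = *(2)[unfolded x]
  have dist: "distinct (N # black_labels t0 @ concat (map black_labels ts))"
    using assms(1) black_labels_insertion(3)[OF ins] by (simp add: valid_tree_def)
  have less: "\<forall>l\<in>set (black_labels t0 @ concat (map black_labels ts)). l < N"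
    using dist le unfolding black_labels_insertion(1)[OF ins] by (auto simp: le_less)
  have zero: "0 \<notin> set (black_labels t0 @ concat (map black_labels ts))"
    using assms(1) unfolding valid_tree_def black_labels_insertion(1)[OF ins] by auto
  have "valid_tree t0"
    using * dist zero by (simp add: valid_tree_def)
  moreover have "valid_tree w" if w: "w \<in> set ts" for w
  proof -
    have "distinct (black_labels w)"
      using dist w by (auto dest: split_list)
    moreover have "sorted_white 0 w"
      using sorted_white_change_parent[of w 0 N] zero less *(5) w x by (auto intro: gr0I)
    ultimately show ?thesis
      using *(6) w x zero by (auto simp: valid_tree_def)
  qed
  ultimately show thesis
    using that[OF ins _ pos dist less] *(6) x by auto
qed

lemma black_labels_Nil: "black_labels t = [] \<Longrightarrow> t = White []"
proof (cases t)
  case (White bs)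
  assume "black_labels t = []"
  then have "black_labels_b b = []" if "b \<in> set bs" for b
    using that White by simp
  then have "bs = []"
    using black_labels_b_ne by (cases bs) auto
  then show ?thesis
    using White by simp
qed

text \<open>The length of \<open>us\<close> encodes the white vertex to which the black vertex \<open>N\<close> is attached.\<close>

inductive corr :: "white_tree \<Rightarrow> 'a list \<Rightarrow> (nat \<Rightarrow> 'a \<Rightarrow> 'a) \<Rightarrow> bool"
  and corrs :: "white_tree list \<Rightarrow> 'a list list \<Rightarrow> (nat \<Rightarrow> 'a \<Rightarrow> 'a) \<Rightarrow> bool" where
  corr_leaf: "corr (White []) [x] (\<lambda>_. id)"
| corr_node: "corr t0 (us @ vs) \<tau>0 \<Longrightarrow> corrs ts bs \<tau>1 \<Longrightarrow> vs \<noteq> [] \<Longrightarrow> ts \<noteq> [] \<Longrightarrow> 0 < N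
    \<Longrightarrow> distinct (N # black_labels t0 @ concat (map black_labels ts))
    \<Longrightarrow> \<forall>l\<in>set (black_labels t0 @ concat (map black_labels ts)). l < N
    \<Longrightarrow> length us < num_white t0 \<Longrightarrow> t = insertions_w 0 (Black N ts) t0 ! length us
    \<Longrightarrow> corr t (us @ concat bs @ vs)
      ((\<lambda>l. \<tau>0 l \<circ> \<tau>1 l)(N := cycle_of_list (map hd bs @ [hd vs])))"
| corrs_Nil: "corrs [] [] (\<lambda>_. id)"
| corrs_Cons: "corr t b \<tau>1 \<Longrightarrow> corrs ts bs \<tau>2 \<Longrightarrow> corrs (t # ts) (b # bs) (\<lambda>l. \<tau>1 l \<circ> \<tau>2 l)"

inductive_cases corrs_NilE: "corrs [] bs \<tau>"
inductive_cases corrs_ConsE: "corrs (t # ts) bs \<tau>"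

lemma ordered_prod_id: "ordered_prod (\<lambda>_. id) K = id"
  by (induction K) auto

lemma excess_id: "excess (\<lambda>_. id) K = 0"
  by (simp add: excess_def cycle_length_id)

definition has_labels :: "(nat \<Rightarrow> 'a \<Rightarrow> 'a) \<Rightarrow> nat set \<Rightarrow> bool" where
  "has_labels \<tau> L \<longleftrightarrow> (\<forall>l. \<tau> l \<noteq> id \<longleftrightarrow> l \<in> L)"

lemma has_labels_unique: "has_labels \<tau> L \<Longrightarrow> has_labels \<tau> L' \<Longrightarrow> L = L'"
  by (auto simp: has_labels_def)

lemma has_labels_disjoint: "has_labels \<tau> L \<Longrightarrow> has_labels \<tau>' L' \<Longrightarrow> L \<inter> L' = {} \<Longrightarrow> \<tau> l = id \<or> \<tau>' l = id"
  by (auto simp: has_labels_def)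

lemma has_labels_comp:
  assumes "has_labels \<tau> L" "has_labels \<tau>' L'" "L \<inter> L' = {}"
  shows "has_labels (\<lambda>l. \<tau> l \<circ> \<tau>' l) (L \<union> L')"
  unfolding has_labels_def
proof
  fix l
  show "\<tau> l \<circ> \<tau>' l \<noteq> id \<longleftrightarrow> l \<in> L \<union> L'"
    using assms has_labels_disjoint[OF assms, of l] unfolding has_labels_def
    by (metis Un_iff comp_id id_comp)
qed

section \<open>What the correspondence guarantees\<close>

text \<open>Disjointness of labels between sibling trees is assumed for \<open>corrs\<close>, since
  \<open>corrs_Cons\<close> does not impose it; \<open>corr_node\<close> supplies it. Quantifying
  over \<open>K\<close> lets the parts be used with bound \<open>N\<close> and the whole with any
  bound above its labels.\<close>

lemma corr_sound:
  fixes \<tau> :: "nat \<Rightarrow> 'a \<Rightarrow> 'a"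
  shows "corr t xs \<tau> \<Longrightarrow> distinct xs \<Longrightarrow>
    valid_tree t \<and> num_white t = length xs \<and> has_labels \<tau> (set (black_labels t))
    \<and> (\<forall>K. (\<forall>l\<in>set (black_labels t). l < K) \<longrightarrow> min_fact K [xs] \<tau>)"
  and "corrs ts bs \<tau> \<Longrightarrow> distinct (concat bs) \<Longrightarrow> distinct (concat (map black_labels ts)) \<Longrightarrow>
    (\<forall>t\<in>set ts. valid_tree t) \<and> map num_white ts = map length bs
    \<and> has_labels \<tau> (set (concat (map black_labels ts)))
    \<and> (\<forall>K. (\<forall>l\<in>set (concat (map black_labels ts)). l < K) \<longrightarrow> min_fact K bs \<tau>)"
proof (induction rule: corr_corrs.inducts)
  case (corr_leaf x)
  have "decreasing [0]" by (simp add: decreasing_def)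
  then have "cyclically_decreasing [0]"
    unfolding cyclically_decreasing_Cons by (intro exI[of _ "[]"]) simp
  moreover have "min_fact K [[x]] (\<lambda>_. id)" for K
    unfolding min_fact_def ordered_prod_id excess_id using is_cycle_id by simp
  moreover have "has_labels (\<lambda>_. id :: 'a \<Rightarrow> 'a) {}"
    unfolding has_labels_def by blast
  ultimately show ?case
    unfolding valid_tree_def by (auto simp del: id_apply)
next
  case (corr_node t0 us vs \<tau>0 ts bs \<tau>1 N t)
  let ?L0 = "set (black_labels t0)" and ?L1 = "set (concat (map black_labels ts))"
  let ?\<tau> = "\<lambda>l. \<tau>0 l \<circ> \<tau>1 l" and ?h = "map hd bs @ [hd vs]"
  have d: "distinct (us @ vs)" "distinct (concat bs)" "set (us @ vs) \<inter> set (concat bs) = {}"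
    using corr_node.prems by auto
  have dl: "distinct (concat (map black_labels ts))" "?L0 \<inter> ?L1 = {}" "N \<notin> ?L0 \<union> ?L1"
    using corr_node.hyps by auto
  have less: "\<forall>l\<in>?L0. l < N" "\<forall>l\<in>?L1. l < N"
    using corr_node.hyps by auto
  note IH0 = corr_node.IH(1)[OF d(1)] and IH1 = corr_node.IH(2)[OF d(2) dl(1)]
  have t: "t \<in> set (insertions_w 0 (Black N ts) t0)"
    using corr_node.hyps by (auto simp: length_insertions)
  note labels = black_labels_insertion(1)[OF t]
  have valid: "valid_tree t"
    using IH0 IH1 corr_node.hyps t by (intro valid_tree_insertion[of t0 ts N t]) auto
  have hl0: "has_labels \<tau>0 ?L0" and hl1: "has_labels \<tau>1 ?L1"
    using IH0 IH1 by blast+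
  have f0: "min_fact N [us @ vs] \<tau>0" and f1: "min_fact N bs \<tau>1"
    using IH0 IH1 less by blast+
  have "min_fact N ([us @ vs] @ bs) ?\<tau>"
    by (rule min_fact_comp[OF f0 f1 _ has_labels_disjoint[OF hl0 hl1 dl(2)]]) (use d(3) in simp)
  moreover have bs: "bs \<noteq> []"
    using IH1 corr_node.hyps by auto
  ultimately have fact: "min_fact (Suc N) [us @ concat bs @ vs] (?\<tau>(N := cycle_of_list ?h))"
    using min_fact_Suc_join[of N us vs bs] corr_node.hyps by simp
  have "distinct ?h"
    using distinct_heads[of "bs @ [vs]"] corr_node.prems corr_node.hyps(3) f1
    by (auto simp: min_fact_def)
  then have "{x. cycle_of_list ?h x \<noteq> x} = set ?h"
    using bs by (intro moved_cycle_of_list) (auto simp: Suc_le_eq)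
  \<comment> \<open>\<open>bs\<close> is nonempty, so the cycle has at least two entries; a trivial
    factor at \<open>N\<close> would hide that label.\<close>
  then have nontriv: "cycle_of_list ?h \<noteq> id"
    by auto
  have "has_labels ?\<tau> (?L0 \<union> ?L1)"
    by (rule has_labels_comp[OF hl0 hl1 dl(2)])
  then have hl: "has_labels (?\<tau>(N := cycle_of_list ?h)) (set (black_labels t))"
    unfolding labels has_labels_def
    by (metis (no_types, lifting) UnCI UnE dl(3) fun_upd_apply insert_iff nontriv)
  have "min_fact K [us @ concat bs @ vs] (?\<tau>(N := cycle_of_list ?h))"
    if "\<forall>l\<in>set (black_labels t). l < K" for K
    using hl that unfolding has_labels_def
    by (intro min_fact_change_bound[OF fact]) (meson not_le)
  moreover have "num_white t = length (us @ concat bs @ vs)"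
    using num_white_insertions(1)[OF t] IH0 IH1 by (simp add: length_concat)
  ultimately show ?case
    using valid hl by blast
next
  case corrs_Nil
  have "min_fact K [] (\<lambda>_. id)" for K
    unfolding min_fact_def ordered_prod_id excess_id using is_cycle_id by simp
  moreover have "has_labels (\<lambda>_. id :: 'a \<Rightarrow> 'a) {}"
    unfolding has_labels_def by blast
  ultimately show ?case
    by (auto simp del: id_apply)
next
  case (corrs_Cons t b \<tau>1 ts bs \<tau>2)
  let ?L1 = "set (black_labels t)" and ?L2 = "set (concat (map black_labels ts))"
  have dl: "?L1 \<inter> ?L2 = {}" "distinct (concat (map black_labels ts))"
    using corrs_Cons.prems by auto
  have d: "distinct b" "distinct (concat bs)" "set b \<inter> set (concat bs) = {}"
    using corrs_Cons.prems by auto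
  note IH1 = corrs_Cons.IH(1)[OF d(1)] and IH2 = corrs_Cons.IH(2)[OF d(2) dl(2)]
  have hl1: "has_labels \<tau>1 ?L1" and hl2: "has_labels \<tau>2 ?L2"
    using IH1 IH2 by blast+
  have "has_labels (\<lambda>l. \<tau>1 l \<circ> \<tau>2 l) (?L1 \<union> ?L2)"
    by (rule has_labels_comp[OF hl1 hl2 dl(1)])
  moreover have "min_fact K ([b] @ bs) (\<lambda>l. \<tau>1 l \<circ> \<tau>2 l)" if "\<forall>l\<in>?L1 \<union> ?L2. l < K" for K
  proof (rule min_fact_comp[OF _ _ _ has_labels_disjoint[OF hl1 hl2 dl(1)]])
    show "min_fact K [b] \<tau>1" "min_fact K bs \<tau>2"
      using IH1 IH2 that by blast+
  qed (use d(3) in simp)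
  ultimately show ?case
    using IH1 IH2 by (simp del: comp_apply)
qed

section \<open>Uniqueness in both directions\<close>

lemma corr_leafD: "corr t xs \<tau> \<Longrightarrow> black_labels t = [] \<Longrightarrow> t = White [] \<and> length xs = 1 \<and> \<tau> = (\<lambda>_. id)"
proof (erule corr.cases)
  fix t0 :: white_tree and us N ts t'
  assume "black_labels t = []" "t = t'" "length us < num_white t0"
    "t' = insertions_w 0 (Black N ts) t0 ! length us"
  then show ?thesis
    using black_labels_insertion(1)[of t 0 N ts t0] by (auto simp: length_insertions)
qed auto

text \<open>Inversion with the new label identified as the maximum, so that derivations for trees
  with the same labels remove the same vertex. The last two facts serve induction on the number of
  labels.\<close>

lemma corr_nodeE:
  assumes "corr t xs \<tau>" "distinct xs" "black_labels t \<noteq> []" "N = Max (set (black_labels t))"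
  obtains us vs bs t0 ts \<tau>0 \<tau>1 where
    "xs = us @ concat bs @ vs" "vs \<noteq> []" "[] \<notin> set bs" "bs \<noteq> []"
    "\<tau> = (\<lambda>l. \<tau>0 l \<circ> \<tau>1 l)(N := cycle_of_list (map hd bs @ [hd vs]))"
    "corr t0 (us @ vs) \<tau>0" "corrs ts bs \<tau>1" "distinct (concat (map black_labels ts))"
    "N \<notin> set (black_labels t0)" "\<tau>0 N = id" "\<tau>1 N = id"
    "\<And>l. \<tau>0 l permutes set (us @ vs)" "\<And>l. \<tau>1 l permutes set (concat bs)"
    "map num_white ts = map length bs" "length us < num_white t0"
    "t = insertions_w 0 (Black N ts) t0 ! length us"
    "length (black_labels t0) < length (black_labels t)"
    "\<And>w. w \<in> set ts \<Longrightarrow> length (black_labels w) < length (black_labels t)"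
  using assms(1)
proof (cases rule: corr.cases)
  case (corr_leaf x)
  then show thesis
    using assms(3) by simp
next
  case (corr_node t0 us vs \<tau>0 ts bs \<tau>1 M)
  have t: "t \<in> set (insertions_w 0 (Black M ts) t0)"
    using corr_node by (auto simp: length_insertions)
  have "Max (set (black_labels t)) = M"
  proof (rule Max_eqI)
    show "y \<le> M" if "y \<in> set (black_labels t)" for y
    proof -
      have "y = M \<or> y < M"
        using that corr_node(9) unfolding black_labels_insertion(1)[OF t] set_append by blast
      then show ?thesis
        by auto
    qed
    show "M \<in> set (black_labels t)"
      unfolding black_labels_insertion(1)[OF t] by blast
  qed simp
  then have "N = M"
    using assms(4) by simp
  have d: "distinct (us @ vs)" "distinct (concat bs)" "distinct (concat (map black_labels ts))"
    using assms(2) corr_node by auto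
  note s0 = corr_sound(1)[OF corr_node(3) d(1)] and s1 = corr_sound(2)[OF corr_node(4) d(2,3)]
  have less: "\<forall>l\<in>set (black_labels t0). l < M" "\<forall>l\<in>set (concat (map black_labels ts)). l < M"
    using corr_node(9) by auto
  have f: "min_fact M [us @ vs] \<tau>0" "min_fact M bs \<tau>1"
    using s0 s1 less by blast+
  have w: "length (black_labels w) < length (black_labels t)" if "w \<in> set ts" for w
    using that black_labels_insertion(2)[OF t] by (auto dest!: split_list)
  have perm: "\<And>l. \<tau>0 l permutes set (us @ vs)" "\<And>l. \<tau>1 l permutes set (concat bs)"
    and triv: "\<tau>0 M = id" "\<tau>1 M = id" and ne: "[] \<notin> set bs"
    using f by (simp_all add: min_fact_def)
  have len: "map num_white ts = map length bs"
    using s1 by blast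
  then have "bs \<noteq> []"
    using corr_node(6) by auto
  moreover have "length (black_labels t0) < length (black_labels t)"
    using black_labels_insertion(2)[OF t] by simp
  moreover have "M \<notin> set (black_labels t0)"
    using less(1) by blast
  ultimately show thesis
    using that[OF corr_node(1) corr_node(5) ne _ _ corr_node(3,4) d(3) _ _ _ perm len corr_node(10)]
      corr_node(2,11) triv w unfolding \<open>N = M\<close> by blast
qed

lemma concat_split_unique:
  assumes "concat bs @ vs = concat bs' @ vs'" "map length bs = map length bs'"
  shows "bs = bs' \<and> vs = vs'"
  using assms
proof (induction bs arbitrary: bs')
  case (Cons b bs)
  then obtain b' cs where bs': "bs' = b' # cs" "length b = length b'" "map length bs = map length cs"
    by (cases bs') auto
  then have "b = b'" "concat bs @ vs = concat cs @ vs'"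
    using Cons.prems(1) by auto
  then show ?case
    using Cons.IH bs' by simp
qed simp

text \<open>The first assumption is the induction hypothesis of \<open>corr_fact_unique\<close> for
  the smaller trees.\<close>

lemma corrs_fact_unique:
  fixes bs :: "'a list list"
  assumes "\<And>t (xs :: 'a list) \<tau> \<tau>'. t \<in> set ts \<Longrightarrow> corr t xs \<tau> \<Longrightarrow> corr t xs \<tau>' \<Longrightarrow> distinct xs \<Longrightarrow> \<tau> = \<tau>'"
    and "corrs ts bs \<tau>" "corrs ts bs \<tau>'" "distinct (concat bs)"
  shows "\<tau> = \<tau>'"
  using assms
proof (induction ts arbitrary: bs \<tau> \<tau>')
  case Nil
  then show ?case
    by (auto elim!: corrs_NilE)
next
  case (Cons t ts)
  from Cons.prems(2) obtain b cs \<tau>1 \<tau>2 where 1: "bs = b # cs" "\<tau> = (\<lambda>l. \<tau>1 l \<circ> \<tau>2 l)"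
    "corr t b \<tau>1" "corrs ts cs \<tau>2"
    by (rule corrs_ConsE)
  from Cons.prems(3) obtain \<tau>1' \<tau>2' where 2: "\<tau>' = (\<lambda>l. \<tau>1' l \<circ> \<tau>2' l)"
    "corr t b \<tau>1'" "corrs ts cs \<tau>2'"
    by (rule corrs_ConsE) (use 1(1) in auto)
  have "\<tau>1 = \<tau>1'"
    by (rule Cons.prems(1)[of t b]) (use 1 2 Cons.prems(4) in auto)
  moreover have "\<tau>2 = \<tau>2'"
  proof (rule Cons.IH[OF _ 1(4) 2(3)])
    show "\<sigma> = \<sigma>'" if "w \<in> set ts" "corr w ys \<sigma>" "corr w ys \<sigma>'" "distinct ys"
      for w \<sigma> \<sigma>' and ys :: "'a list"
      using that by (intro Cons.prems(1)[of w ys]) auto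
    show "distinct (concat cs)"
      using Cons.prems(4) 1(1) by simp
  qed
  ultimately show ?case
    using 1(2) 2(1) by simp
qed

text \<open>Removing and finding the vertex \<open>N\<close> recovers \<open>t0\<close> and
  \<open>ts\<close>; since the insertions are distinct, the index of \<open>t\<close> determines the
  length of \<open>us\<close>; the sizes of the trees in \<open>ts\<close> determine the cuts
  between the blocks.\<close>

lemma corr_fact_unique: "corr t xs \<tau> \<Longrightarrow> corr t xs \<tau>' \<Longrightarrow> distinct xs \<Longrightarrow> \<tau> = \<tau>'"
proof (induction "length (black_labels t)" arbitrary: t xs \<tau> \<tau>' rule: less_induct)
  case less
  show ?case
  proof (cases "black_labels t = []")
    case True
    then show ?thesis
      using corr_leafD[OF less.prems(1)] corr_leafD[OF less.prems(2)] by simp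
  next
    case False
    define N where "N = Max (set (black_labels t))"
    from less.prems(1,3) False N_def obtain us vs bs t0 ts \<tau>0 \<tau>1 where 1:
      "xs = us @ concat bs @ vs"
      "\<tau> = (\<lambda>l. \<tau>0 l \<circ> \<tau>1 l)(N := cycle_of_list (map hd bs @ [hd vs]))"
      "corr t0 (us @ vs) \<tau>0" "corrs ts bs \<tau>1" "N \<notin> set (black_labels t0)"
      "map num_white ts = map length bs" "length us < num_white t0"
      "t = insertions_w 0 (Black N ts) t0 ! length us"
      "length (black_labels t0) < length (black_labels t)"
      "\<And>w. w \<in> set ts \<Longrightarrow> length (black_labels w) < length (black_labels t)"
      by (rule corr_nodeE) blast
    from less.prems(2,3) False N_def obtain us' vs' bs' t0' ts' \<tau>0' \<tau>1' where 2:
      "xs = us' @ concat bs' @ vs'"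
      "\<tau>' = (\<lambda>l. \<tau>0' l \<circ> \<tau>1' l)(N := cycle_of_list (map hd bs' @ [hd vs']))"
      "corr t0' (us' @ vs') \<tau>0'" "corrs ts' bs' \<tau>1'" "N \<notin> set (black_labels t0')"
      "map num_white ts' = map length bs'" "length us' < num_white t0'"
      "t = insertions_w 0 (Black N ts') t0' ! length us'"
      by (rule corr_nodeE) blast
    have t: "t \<in> set (insertions_w 0 (Black N ts) t0)" "t \<in> set (insertions_w 0 (Black N ts') t0')"
      using 1(7,8) 2(7,8) by (metis length_insertions(1) nth_mem)+
    have "t0 = t0'"
      using remove_insertions(1)[OF t(1)] remove_insertions(1)[OF t(2)] 1(5) 2(5) by simp
    moreover have "ts = ts'"
      using find_insertions(1)[OF t(1)] find_insertions(1)[OF t(2)] 1(5) 2(5) by simp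
    ultimately have eq: "t0' = t0" "ts' = ts"
      by simp_all
    have "length us = length us'"
      using 1(7,8) 2(7,8) distinct_insertions(1)[of 0 "Black N ts" t0] unfolding eq
      by (metis length_insertions(1) nth_eq_iff_index_eq)
    then have "us' = us" "concat bs @ vs = concat bs' @ vs'"
      using 1(1) 2(1) by auto
    moreover from this(2) have "bs = bs' \<and> vs = vs'"
      by (rule concat_split_unique) (use 1(6) 2(6) eq in simp)
    ultimately have eq': "us' = us" "bs' = bs" "vs' = vs"
      by simp_all
    have "\<tau>0 = \<tau>0'"
      by (rule less.hyps[OF 1(9,3) 2(3)[unfolded eq eq']]) (use less.prems(3) 1(1) in auto)
    moreover have "\<tau>1 = \<tau>1'"
      by (rule corrs_fact_unique[OF less.hyps[OF 1(10)] 1(4) 2(4)[unfolded eq eq']])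
        (use less.prems(3) 1(1) in auto)
    ultimately show ?thesis
      using 1(2) 2(2) eq' by simp
  qed
qed

lemma corrs_tree_unique:
  fixes bs :: "'a list list"
  assumes "\<And>t t' (xs :: 'a list) \<tau>. t \<in> set ts \<Longrightarrow> corr t xs \<tau> \<Longrightarrow> corr t' xs \<tau> \<Longrightarrow> distinct xs \<Longrightarrow> t = t'"
    and "corrs ts bs \<tau>" "corrs ts' bs \<tau>" "distinct (concat bs)"
    and "distinct (concat (map black_labels ts))" "distinct (concat (map black_labels ts'))"
  shows "ts = ts'"
  using assms
proof (induction ts arbitrary: ts' bs \<tau>)
  case Nil
  then show ?case
    by (auto elim!: corrs_NilE elim: corrs.cases)
next
  case (Cons t ts)
  from Cons.prems(2) obtain b cs \<tau>1 \<tau>2 where 1: "bs = b # cs" "\<tau> = (\<lambda>l. \<tau>1 l \<circ> \<tau>2 l)"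
    "corr t b \<tau>1" "corrs ts cs \<tau>2"
    by (rule corrs_ConsE)
  from Cons.prems(3) 1(1) obtain t' us \<tau>1' \<tau>2' where 2: "ts' = t' # us" "\<tau> = (\<lambda>l. \<tau>1' l \<circ> \<tau>2' l)"
    "corr t' b \<tau>1'" "corrs us cs \<tau>2'"
    by (auto elim: corrs.cases)
  have d: "distinct b" "distinct (concat cs)" "set b \<inter> set (concat cs) = {}"
    "distinct (concat (map black_labels ts))" "distinct (concat (map black_labels us))"
    using Cons.prems 1(1) 2(1) by auto
  \<comment> \<open>Any bound above the finitely many labels will do; the facts are used for the
    supports of the factors.\<close>
  have "\<exists>K. min_fact K [b] \<tau>1" "\<exists>K. min_fact K [b] \<tau>1'" "\<exists>K. min_fact K cs \<tau>2" "\<exists>K. min_fact K cs \<tau>2'"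
    using corr_sound(1)[OF 1(3) d(1)] corr_sound(1)[OF 2(3) d(1)]
      corr_sound(2)[OF 1(4) d(2,4)] corr_sound(2)[OF 2(4) d(2,5)]
    by (meson finite_nat_set_iff_bounded finite_set)+
  then have "\<tau>1 l permutes set b" "\<tau>1' l permutes set b" "\<tau>2 l permutes set (concat cs)"
    "\<tau>2' l permutes set (concat cs)" for l
    by (auto simp: min_fact_def)
  then have "\<tau>1 l = \<tau>1' l \<and> \<tau>2 l = \<tau>2' l" for l
    using fun_cong[OF trans[OF 1(2)[symmetric] 2(2)], of l] d(3)
    by (intro disjoint_permutes_comp_unique[of _ "set b" _ "set (concat cs)"]) auto
  then have eq: "\<tau>1' = \<tau>1" "\<tau>2' = \<tau>2"
    by auto
  have "t = t'"
    by (rule Cons.prems(1)[of t b \<tau>1]) (use 1(3) 2(3) eq d(1) in auto)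
  moreover have "ts = us"
  proof (rule Cons.IH[OF _ 1(4) 2(4)[unfolded eq] d(2,4,5)])
    show "w = w'" if "w \<in> set ts" "corr w ys \<sigma>" "corr w' ys \<sigma>" "distinct ys"
      for w w' \<sigma> and ys :: "'a list"
      using that by (intro Cons.prems(1)[of w ys \<sigma>]) auto
  qed
  ultimately show ?case
    using 2(1) by simp
qed

text \<open>The nontrivial factors show the labels, hence \<open>N\<close>; the points moved by
  \<open>\<tau> N\<close> determine the cut of \<open>xs\<close> by \<open>blocks_unique\<close>;
  the other factors separate along the disjoint supports of \<open>us @ vs\<close> and
  \<open>concat bs\<close>.\<close>

lemma corr_tree_unique: "corr t xs \<tau> \<Longrightarrow> corr t' xs \<tau> \<Longrightarrow> distinct xs \<Longrightarrow> t = t'"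
proof (induction "length (black_labels t)" arbitrary: t t' xs \<tau> rule: less_induct)
  case less
  have same: "set (black_labels t) = set (black_labels t')"
    using corr_sound(1)[OF less.prems(1,3)] corr_sound(1)[OF less.prems(2,3)] has_labels_unique by blast
  show ?case
  proof (cases "black_labels t = []")
    case True
    moreover from this same have "black_labels t' = []"
      by simp
    ultimately show ?thesis
      using corr_leafD[OF less.prems(1)] corr_leafD[OF less.prems(2)] by simp
  next
    case False
    with same have False': "black_labels t' \<noteq> []"
      by auto
    define N where "N = Max (set (black_labels t))"
    then have N': "N = Max (set (black_labels t'))"
      using same by simp
    from less.prems(1,3) False N_def obtain us vs bs t0 ts \<tau>0 \<tau>1 where 1:
      "xs = us @ concat bs @ vs" "vs \<noteq> []" "[] \<notin> set bs" "bs \<noteq> []"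
      "\<tau> = (\<lambda>l. \<tau>0 l \<circ> \<tau>1 l)(N := cycle_of_list (map hd bs @ [hd vs]))"
      "corr t0 (us @ vs) \<tau>0" "corrs ts bs \<tau>1" "distinct (concat (map black_labels ts))"
      "\<tau>0 N = id" "\<tau>1 N = id"
      "\<And>l. \<tau>0 l permutes set (us @ vs)" "\<And>l. \<tau>1 l permutes set (concat bs)"
      "t = insertions_w 0 (Black N ts) t0 ! length us"
      "length (black_labels t0) < length (black_labels t)"
      "\<And>w. w \<in> set ts \<Longrightarrow> length (black_labels w) < length (black_labels t)"
      by (rule corr_nodeE) blast
    from less.prems(2,3) False' N' obtain us' vs' bs' t0' ts' \<tau>0' \<tau>1' where 2:
      "xs = us' @ concat bs' @ vs'" "vs' \<noteq> []" "[] \<notin> set bs'" "bs' \<noteq> []"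
      "\<tau> = (\<lambda>l. \<tau>0' l \<circ> \<tau>1' l)(N := cycle_of_list (map hd bs' @ [hd vs']))"
      "corr t0' (us' @ vs') \<tau>0'" "corrs ts' bs' \<tau>1'" "distinct (concat (map black_labels ts'))"
      "\<tau>0' N = id" "\<tau>1' N = id"
      "\<And>l. \<tau>0' l permutes set (us' @ vs')" "\<And>l. \<tau>1' l permutes set (concat bs')"
      "t' = insertions_w 0 (Black N ts') t0' ! length us'"
      by (rule corr_nodeE) blast
    define X where "X = {x. \<tau> N x \<noteq> x}"
    have blocks: "X = hd ` set (cs @ [v]) \<and> blocks X (cs @ [v]) \<and> set u \<inter> X = {}"
      if "xs = u @ concat cs @ v" "v \<noteq> []" "[] \<notin> set cs" "cs \<noteq> []"
        "\<tau> N = cycle_of_list (map hd cs @ [hd v])" for u v cs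
    proof -
      have dc: "distinct (concat (cs @ [v]))" "[] \<notin> set (cs @ [v])" "set u \<inter> set (concat (cs @ [v])) = {}"
        using that less.prems(3) by auto
      have "distinct (map hd cs @ [hd v])"
        using distinct_heads[OF dc(1,2)] by simp
      \<comment> \<open>At least two heads are present because \<open>cs\<close> is nonempty, so all
        of them are moved.\<close>
      then have X: "X = hd ` set (cs @ [v])"
        unfolding X_def that(5) using that(4) by (subst moved_cycle_of_list) (auto simp: Suc_le_eq)
      then have "blocks X (cs @ [v])"
        by (rule blocks_if_heads[OF dc(1,2)])
      moreover have "X \<subseteq> set (concat (cs @ [v]))"
        using blocks_heads[OF calculation] X by blast
      ultimately show ?thesis
        using X dc(3) by blast
    qed
    have b1: "blocks X (bs @ [vs])" "set us \<inter> X = {}"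
      using blocks[OF 1(1-4)] unfolding 1(5) fun_upd_same by blast+
    have b2: "blocks X (bs' @ [vs'])" "set us' \<inter> X = {}"
      using blocks[OF 2(1-4)] unfolding 2(5) fun_upd_same by blast+
    have "us = us' \<and> bs @ [vs] = bs' @ [vs']"
      by (rule blocks_unique[OF _ b1(2) b2(2) b1(1) b2(1)]) (use 1(1) 2(1) in simp)
    then have eq: "us' = us" "bs' = bs" "vs' = vs"
      by simp_all
    have disj: "set (us @ vs) \<inter> set (concat bs) = {}" "distinct (us @ vs)" "distinct (concat bs)"
      using less.prems(3) 1(1) by auto
    \<comment> \<open>At \<open>N\<close> both presentations of \<tau> are overwritten; there all
      four parts are the identity.\<close>
    have "\<tau>0 l \<circ> \<tau>1 l = \<tau>0' l \<circ> \<tau>1' l" for l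
    proof (cases "l = N")
      case True
      then show ?thesis
        using 1(9,10) 2(9,10) by simp
    next
      case False
      then show ?thesis
        using fun_cong[OF trans[OF 1(5)[symmetric] 2(5)], of l] by simp
    qed
    then have "\<tau>0 l = \<tau>0' l \<and> \<tau>1 l = \<tau>1' l" for l
      using 1(11,12) 2(11,12) unfolding eq by (intro disjoint_permutes_comp_unique[OF _ _ disj(1)])
    then have eq': "\<tau>0' = \<tau>0" "\<tau>1' = \<tau>1"
      by auto
    have "t0 = t0'"
      by (rule less.hyps[OF 1(14,6) 2(6)[unfolded eq eq'] disj(2)])
    moreover have "ts = ts'"
      by (rule corrs_tree_unique[OF less.hyps[OF 1(15)] 1(7) 2(7)[unfolded eq eq'] disj(3) 1(8) 2(8)])
    ultimately show ?thesis
      using 1(13) 2(13) eq by simp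
  qed
qed

section \<open>Existence in both directions\<close>

lemma split_by_lengths: "length xs = sum_list ns \<Longrightarrow> \<exists>bs. concat bs = xs \<and> map length bs = ns"
proof (induction ns arbitrary: xs)
  case (Cons n ns)
  then obtain bs where "concat bs = drop n xs" "map length bs = ns"
    by (metis add_diff_cancel_left' length_drop sum_list.Cons)
  then show ?case
    using Cons.prems by (intro exI[of _ "take n xs # bs"]) simp
qed simp

lemma corrs_exist:
  fixes bs :: "'a list list"
  assumes "\<And>w (xs :: 'a list). w \<in> set ts \<Longrightarrow> length xs = num_white w \<Longrightarrow> \<exists>\<tau>. corr w xs \<tau>"
    and "map length bs = map num_white ts"
  shows "\<exists>\<tau>. corrs ts bs \<tau>"
  using assms
proof (induction ts arbitrary: bs)
  case Nil
  then show ?case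
    using corrs_Nil by auto
next
  case (Cons t ts)
  then obtain b cs where bs: "bs = b # cs" "length b = num_white t" "map length cs = map num_white ts"
    by (cases bs) auto
  obtain \<tau>1 where "corr t b \<tau>1"
    using Cons.prems(1)[of t b] bs(2) by fastforce
  moreover have "\<exists>\<tau>. corrs ts cs \<tau>"
    by (rule Cons.IH) (use Cons.prems(1) bs(3) in auto)
  then obtain \<tau>2 where "corrs ts cs \<tau>2" ..
  ultimately show ?case
    using corrs_Cons bs(1) by blast
qed

text \<open>The index of \<open>t\<close> among the insertions into \<open>t0\<close> fixes the
  length of \<open>us\<close>, and the sizes of the trees in \<open>ts\<close> fix how the next
  stretch of the word is cut into blocks.\<close>

lemma corr_fact_exists:
  "valid_tree t \<Longrightarrow> length xs = num_white t \<Longrightarrow> \<exists>\<tau>. corr t xs \<tau>"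
proof (induction "length (black_labels t)" arbitrary: t xs rule: less_induct)
  case less
  show ?case
  proof (cases "black_labels t = []")
    case True
    then have t: "t = White []"
      by (rule black_labels_Nil)
    then obtain x where "xs = [x]"
      using less.prems(2) by (auto simp: length_Suc_conv)
    then show ?thesis
      using corr_leaf t by metis
  next
    case False
    obtain t0 ts N where *: "t \<in> set (insertions_w 0 (Black N ts) t0)" "ts \<noteq> []" "0 < N"
      "distinct (N # black_labels t0 @ concat (map black_labels ts))"
      "\<forall>l\<in>set (black_labels t0 @ concat (map black_labels ts)). l < N"
      "valid_tree t0" "\<forall>w\<in>set ts. valid_tree w"
      by (rule valid_tree_decompose[OF less.prems(1) refl False])
    obtain i where i: "i < num_white t0" "t = insertions_w 0 (Black N ts) t0 ! i"
      using *(1) by (metis in_set_conv_nth length_insertions(1))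
    define s where "s = sum_list (map num_white ts)"
    have len: "length xs = s + num_white t0"
      using num_white_insertions(1)[OF *(1)] less.prems(2) by (simp add: s_def)
    define us where "us = take i xs"
    define vs where "vs = drop (i + s) xs"
    \<comment> \<open>\<open>vs\<close> is nonempty because \<open>i < num_white t0\<close>.\<close>
    have us: "length us = i" "length (us @ vs) = num_white t0" "vs \<noteq> []"
      using i(1) len by (auto simp: us_def vs_def)
    have "length (take s (drop i xs)) = sum_list (map num_white ts)"
      using i(1) len by (simp add: s_def)
    then obtain bs where bs: "concat bs = take s (drop i xs)" "map length bs = map num_white ts"
      using split_by_lengths by blast
    have xs: "xs = us @ concat bs @ vs"
      unfolding bs(1) us_def vs_def by (metis append_take_drop_id drop_drop add.commute)
    have smaller: "length (black_labels t0) < length (black_labels t)"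
      "\<And>w. w \<in> set ts \<Longrightarrow> length (black_labels w) < length (black_labels t)"
      using black_labels_insertion(2)[OF *(1)] by (auto dest!: split_list)
    obtain \<tau>0 where "corr t0 (us @ vs) \<tau>0"
      using less.hyps[OF smaller(1) *(6) us(2)] by blast
    moreover obtain \<tau>1 where "corrs ts bs \<tau>1"
      using corrs_exist[OF less.hyps[OF smaller(2)] bs(2)] *(7) by blast
    ultimately show ?thesis
      unfolding xs using corr_node[of t0 us vs _ ts bs _ N t] us i * by blast
  qed
qed

text \<open>The first assumption is the induction hypothesis of \<open>corr_tree_exists\<close>.
  Minimality splits the factorization block by block, with one of the two parts trivial at each
  label, so the trees get disjoint labels.\<close>

lemma corrs_of_min_fact:
  fixes bs :: "'a list list"
  assumes "\<And>(xs :: 'a list) \<tau>. min_fact N [xs] \<tau> \<Longrightarrow> \<tau> 0 = id \<Longrightarrow> \<exists>t. corr t xs \<tau>"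
    and "min_fact N bs \<tau>" "\<tau> 0 = id"
  shows "\<exists>ts. corrs ts bs \<tau> \<and> distinct (concat (map black_labels ts))"
  using assms(2,3)
proof (induction bs arbitrary: \<tau>)
  case Nil
  then have "\<tau> = (\<lambda>_. id)"
    by (auto simp: min_fact_def)
  then have "corrs [] [] \<tau>"
    using corrs_Nil by (simp only:)
  then show ?case
    by (intro exI[of _ "[]"]) simp
next
  case (Cons b bs)
  obtain \<tau>1 \<tau>2 where *: "min_fact N [b] \<tau>1" "min_fact N bs \<tau>2" "\<tau> = (\<lambda>l. \<tau>1 l \<circ> \<tau>2 l)"
    "\<And>l. \<tau>1 l = id \<or> \<tau>2 l = id"
    using min_fact_split[OF Cons.prems(1)] by blast
  have "\<tau>1 0 \<circ> \<tau>2 0 = id"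
    using *(3) Cons.prems(2) by metis
  then have zero: "\<tau>1 0 = id" "\<tau>2 0 = id"
    using *(4)[of 0] by auto
  obtain t where t: "corr t b \<tau>1"
    using assms(1)[OF *(1) zero(1)] by blast
  obtain ts where ts: "corrs ts bs \<tau>2" "distinct (concat (map black_labels ts))"
    using Cons.IH[OF *(2) zero(2)] by blast
  have d: "distinct b" "distinct (concat bs)"
    using *(1,2) by (auto simp: min_fact_def)
  have "set (black_labels t) \<inter> set (concat (map black_labels ts)) = {}"
    using corr_sound(1)[OF t d(1)] corr_sound(2)[OF ts(1) d(2) ts(2)] *(4)
    unfolding has_labels_def by blast
  moreover have "distinct (black_labels t)"
    using corr_sound(1)[OF t d(1)] by (simp add: valid_tree_def)
  ultimately show ?case
    using corrs_Cons[OF t ts(1)] ts(2) *(3)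
    by (intro exI[of _ "t # ts"]) (auto simp del: comp_apply)
qed

lemma corr_tree_exists:
  "min_fact K [xs] \<tau> \<Longrightarrow> \<tau> 0 = id \<Longrightarrow> \<exists>t. corr t xs \<tau>"
proof (induction K arbitrary: xs \<tau>)
  case 0
  then have "\<tau> = (\<lambda>_. id)" "length xs = 1"
    by (auto simp: min_fact_def excess_def intro!: le_antisym Suc_leI)
  then obtain x where "xs = [x]"
    by (auto simp: length_Suc_conv)
  then show ?case
    using corr_leaf[of x] \<open>\<tau> = (\<lambda>_. id)\<close> by metis
next
  case (Suc N)
  show ?case
  proof (cases "\<tau> N = id")
    case True
    have "\<tau> l = id" if "l \<ge> N" for l
      using that True Suc.prems(1) by (cases "l = N") (auto simp: min_fact_def)
    then show ?thesis
      using Suc.IH[OF min_fact_change_bound[OF Suc.prems(1)] Suc.prems(2)] by blast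
  next
    case False
    then obtain us bs vs where xs: "xs = us @ concat bs @ vs" "bs \<noteq> []" "vs \<noteq> []"
      "\<tau> N = cycle_of_list (map hd bs @ [hd vs])" "min_fact N ((us @ vs) # bs) (\<tau>(N := id))"
      using min_fact_Suc_split[OF Suc.prems(1)] by blast
    obtain \<tau>0 \<tau>1 where *: "min_fact N [us @ vs] \<tau>0" "min_fact N bs \<tau>1"
      "\<tau>(N := id) = (\<lambda>l. \<tau>0 l \<circ> \<tau>1 l)" "\<And>l. \<tau>0 l = id \<or> \<tau>1 l = id"
      using min_fact_split[OF xs(5)] by blast
    have "\<tau>0 0 \<circ> \<tau>1 0 = id"
      using fun_cong[OF *(3), of 0] Suc.prems(2) by (metis fun_upd_apply)
    then have zero: "\<tau>0 0 = id" "\<tau>1 0 = id"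
      using *(4)[of 0] by auto
    obtain t0 where t0: "corr t0 (us @ vs) \<tau>0"
      using Suc.IH[OF *(1) zero(1)] by blast
    obtain ts where ts: "corrs ts bs \<tau>1" "distinct (concat (map black_labels ts))"
      using corrs_of_min_fact[OF Suc.IH *(2) zero(2)] by blast
    have d: "distinct (us @ vs)" "distinct (concat bs)"
      using *(1,2) by (auto simp: min_fact_def)
    note s0 = corr_sound(1)[OF t0 d(1)] and s1 = corr_sound(2)[OF ts(1) d(2) ts(2)]
    have less: "\<forall>l\<in>set (black_labels t0 @ concat (map black_labels ts)). l < N"
    proof
      fix l assume "l \<in> set (black_labels t0 @ concat (map black_labels ts))"
      then have "\<tau>0 l \<noteq> id \<or> \<tau>1 l \<noteq> id"
        using s0 s1 unfolding has_labels_def by auto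
      then show "l < N"
        using *(1,2) unfolding min_fact_def by (meson not_le)
    qed
    have "set (black_labels t0) \<inter> set (concat (map black_labels ts)) = {}"
      using s0 s1 *(4) unfolding has_labels_def by blast
    moreover have "distinct (black_labels t0)"
      using s0 by (simp add: valid_tree_def)
    ultimately have dist: "distinct (N # black_labels t0 @ concat (map black_labels ts))"
      using less ts(2) by auto
    have "ts \<noteq> []" "length us < num_white t0"
      using s0 s1 xs(2,3) by auto
    moreover have "0 < N"
      using False Suc.prems(2) by (auto intro: gr0I)
    moreover have "\<tau> = (\<lambda>l. \<tau>0 l \<circ> \<tau>1 l)(N := cycle_of_list (map hd bs @ [hd vs]))"
      using *(3) xs(4) by (metis fun_upd_triv fun_upd_upd)
    ultimately show ?thesis
      using corr_node[OF t0 ts(1) xs(3) _ _ dist less _ refl] xs(1) by metis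
  qed
qed

section \<open>Lists of factors\<close>

text \<open>Shifts list positions, which start at 0, to labels, which start at 1.\<close>

definition fact_of_list :: "('a \<Rightarrow> 'a) list \<Rightarrow> nat \<Rightarrow> 'a \<Rightarrow> 'a" where
  "fact_of_list \<tau>s l = (if 1 \<le> l \<and> l \<le> length \<tau>s then \<tau>s ! (l - 1) else id)"

lemma ordered_prod_fact_of_list:
  "ordered_prod (fact_of_list \<tau>s) (Suc (length \<tau>s)) = prod_lr \<tau>s"
proof -
  have "m \<le> length \<tau>s \<Longrightarrow> ordered_prod (fact_of_list \<tau>s) (Suc m) = prod_lr (take m \<tau>s)" for m
  proof (induction m)
    case 0
    show ?case
      by (simp add: fact_of_list_def prod_lr_def)
  next
    case (Suc m)
    have "ordered_prod (fact_of_list \<tau>s) (Suc (Suc m)) = \<tau>s ! m \<circ> prod_lr (take m \<tau>s)"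
      using Suc by (simp only: ordered_prod.simps(2)[of _ "Suc m"]) (simp add: fact_of_list_def)
    then show ?case
      using Suc.prems by (simp only: prod_lr_def take_Suc_conv_app_nth Suc_le_eq) simp
  qed
  from this[of "length \<tau>s"] show ?thesis
    by simp
qed

lemma excess_fact_of_list:
  "excess (fact_of_list \<tau>s) (Suc (length \<tau>s)) = (\<Sum>\<tau>\<leftarrow>\<tau>s. cycle_length \<tau> - 1)"
proof -
  have "excess (fact_of_list \<tau>s) (Suc (length \<tau>s)) = (\<Sum>l<length \<tau>s. cycle_length (\<tau>s ! l) - 1)"
    unfolding excess_def by (subst sum.lessThan_Suc_shift) (simp add: fact_of_list_def cycle_length_id)
  then show ?thesis
    by (simp add: sum_list_sum_nth atLeast0LessThan)
qed

lemma fact_of_list_all: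
  assumes "P id"
  shows "(\<forall>l. P (fact_of_list \<tau>s l)) \<longleftrightarrow> (\<forall>\<tau>\<in>set \<tau>s. P \<tau>)"
proof
  assume *: "\<forall>l. P (fact_of_list \<tau>s l)"
  show "\<forall>\<tau>\<in>set \<tau>s. P \<tau>"
  proof
    fix \<tau> assume "\<tau> \<in> set \<tau>s"
    then obtain i where "i < length \<tau>s" "\<tau> = \<tau>s ! i"
      by (auto simp: in_set_conv_nth)
    then show "P \<tau>"
      using *[rule_format, of "Suc i"] by (simp add: fact_of_list_def)
  qed
next
  assume "\<forall>\<tau>\<in>set \<tau>s. P \<tau>"
  then show "\<forall>l. P (fact_of_list \<tau>s l)"
    using assms by (auto simp: fact_of_list_def)
qed

lemma cycle_length_ge_2:
  assumes "is_cycle \<tau>" "\<tau> \<noteq> id"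
  shows "cycle_length \<tau> \<ge> 2"
proof -
  obtain cs where cs: "distinct cs" "\<tau> = cycle_of_list cs"
    using assms(1) by (auto simp: is_cycle_def)
  then have "length cs \<ge> 2"
    using assms(2) cycle_of_list_short[of cs] by force
  then show ?thesis
    using cycle_length_cycle_of_list cs by metis
qed

text \<open>A cycle has length at least 2 exactly when it is not the identity, so the length
  condition becomes the absence of \<open>id\<close> from the list.\<close>

lemma min_factorizations_k_iff:
  assumes "n \<ge> 1"
  shows "\<tau>s \<in> min_factorizations_k n (length \<tau>s) \<longleftrightarrow>
    min_fact (Suc (length \<tau>s)) [[1..<Suc n]] (fact_of_list \<tau>s) \<and> id \<notin> set \<tau>s"
proof -
  let ?P = "\<lambda>\<tau>. \<tau> permutes {1..n} \<and> is_cycle \<tau>"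
  have long: "cycle_length \<tau> \<ge> 2 \<longleftrightarrow> \<tau> \<noteq> id" if "is_cycle \<tau>" for \<tau> :: "nat \<Rightarrow> nat"
    using cycle_length_ge_2[OF that] by (auto simp: cycle_length_def)
  have set: "set (concat [[1..<Suc n]]) = {1..n}" "distinct (concat [[1..<Suc n]])"
    "[] \<notin> set [[1..<Suc n]]" "cycles_of_lists [[1..<Suc n]] = long_cycle n"
    "(\<Sum>b\<leftarrow>[[1..<Suc n]]. length b - 1) = n - 1"
    using assms upt_eq_Nil_conv[of 1 "Suc n"]
    by (auto simp: long_cycle_def simp del: upt_Suc upt_eq_Nil_conv)
  have "\<forall>l\<ge>Suc (length \<tau>s). fact_of_list \<tau>s l = id"
    by (auto simp: fact_of_list_def)
  moreover have "?P id"
    by (simp add: permutes_id is_cycle_id)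
  ultimately have "min_fact (Suc (length \<tau>s)) [[1..<Suc n]] (fact_of_list \<tau>s) \<longleftrightarrow>
    (\<forall>\<tau>\<in>set \<tau>s. ?P \<tau>) \<and> prod_lr \<tau>s = long_cycle n \<and> (\<Sum>\<tau>\<leftarrow>\<tau>s. cycle_length \<tau> - 1) = n - 1"
    unfolding min_fact_def set ordered_prod_fact_of_list excess_fact_of_list
    using fact_of_list_all[of ?P \<tau>s] set(2,3) by blast
  then show ?thesis
    unfolding min_factorizations_k_def using long by blast
qed

lemma has_labels_fact_of_list:
  assumes "id \<notin> set \<tau>s"
  shows "has_labels (fact_of_list \<tau>s) {1..length \<tau>s}"
  unfolding has_labels_def
proof
  fix l
  have "\<tau>s ! (l - 1) \<in> set \<tau>s" if "l \<in> {1..length \<tau>s}"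
    using that by (intro nth_mem) auto
  then show "fact_of_list \<tau>s l \<noteq> id \<longleftrightarrow> l \<in> {1..length \<tau>s}"
    using assms by (metis atLeastAtMost_iff fact_of_list_def)
qed

lemma fact_of_list_map:
  assumes "has_labels \<tau> {1..k}"
  shows "fact_of_list (map \<tau> [1..<Suc k]) = \<tau>"
proof
  fix l
  show "fact_of_list (map \<tau> [1..<Suc k]) l = \<tau> l"
  proof (cases "l \<in> {1..k}")
    case True
    then have "map \<tau> [1..<Suc k] ! (l - 1) = \<tau> l"
      by (subst nth_map) (auto simp del: upt_Suc)
    then show ?thesis
      using True by (simp add: fact_of_list_def del: upt_Suc)
  next
    case False
    then have "\<tau> l = id"
      using assms unfolding has_labels_def by blast
    then show ?thesis
      using False by (auto simp: fact_of_list_def)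
  qed
qed

lemma labelled_trees_iff:
  "t \<in> labelled_trees n \<longleftrightarrow>
    valid_tree t \<and> num_white t = n \<and> num_black t \<ge> 1 \<and> set (black_labels t) = {1..num_black t}"
proof -
  have "sorted_white 0 t \<longleftrightarrow> sorted_root t" if "0 \<notin> set (black_labels t)"
  proof (cases t)
    case (White bs)
    have "0 < label b" if b: "b \<in> set bs" for b
      using \<open>0 \<notin> set (black_labels t)\<close> White b label_in_black_labels[of b] by (auto intro: gr0I)
    then show ?thesis
      using cyclically_decreasing_less[of "map label bs" 0] White by auto
  qed
  then show ?thesis
    unfolding labelled_trees_def valid_tree_def by auto
qed

theorem theorem1p4:
  fixes n :: nat
  assumes "n \<ge> 1"
  shows "\<exists>f. bij_betw f (min_factorizations n) (labelled_trees n)"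
proof -
  let ?xs = "[1..<Suc n]"
  define R where "R \<tau>s t \<longleftrightarrow> corr t ?xs (fact_of_list \<tau>s)" for \<tau>s t
  have dist: "distinct ?xs"
    by (rule distinct_upt)
  have memb: "\<tau>s \<in> min_factorizations n \<longleftrightarrow> length \<tau>s \<in> {1..n - 1} \<and>
      min_fact (Suc (length \<tau>s)) [?xs] (fact_of_list \<tau>s) \<and> id \<notin> set \<tau>s" for \<tau>s
  proof -
    have "\<tau>s \<in> min_factorizations n \<longleftrightarrow>
        length \<tau>s \<in> {1..n - 1} \<and> \<tau>s \<in> min_factorizations_k n (length \<tau>s)"
      by (auto simp: min_factorizations_def min_factorizations_k_def)
    then show ?thesis
      using min_factorizations_k_iff[OF assms] by blast
  qed
  have total: "\<exists>t. R \<tau>s t \<and> t \<in> labelled_trees n" if \<tau>s: "\<tau>s \<in> min_factorizations n" for \<tau>s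
  proof -
    have "fact_of_list \<tau>s 0 = id"
      by (simp add: fact_of_list_def)
    then obtain t where t: "corr t ?xs (fact_of_list \<tau>s)"
      using corr_tree_exists \<tau>s unfolding memb by blast
    note sound = corr_sound(1)[OF t dist]
    \<comment> \<open>A list without \<open>id\<close> has its nontrivial factors exactly at the
      labels from 1 to its length, and these are the labels of the tree.\<close>
    have labels: "set (black_labels t) = {1..length \<tau>s}"
      using sound has_labels_fact_of_list \<tau>s has_labels_unique unfolding memb by blast
    then have "num_black t = length \<tau>s"
      using sound distinct_card[of "black_labels t"] by (simp add: num_black_def valid_tree_def)
    then have "t \<in> labelled_trees n"
      using sound labels \<tau>s assms unfolding labelled_trees_iff memb by (simp del: upt_Suc)
    then show ?thesis
      using t R_def by blast
  qed
  have surj: "\<exists>\<tau>s. R \<tau>s t \<and> \<tau>s \<in> min_factorizations n" if t: "t \<in> labelled_trees n" for t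
  proof -
    let ?k = "num_black t"
    obtain \<tau> where \<tau>: "corr t ?xs \<tau>"
      using corr_fact_exists[of t ?xs] t by (auto simp: labelled_trees_iff simp del: upt_Suc)
    note sound = corr_sound(1)[OF \<tau> dist]
    have labels: "set (black_labels t) = {1..?k}" and k: "?k \<ge> 1"
      using t by (simp_all add: labelled_trees_iff)
    then have hl: "has_labels \<tau> {1..?k}"
      using sound by simp
    define \<tau>s where "\<tau>s = map \<tau> [1..<Suc ?k]"
    have eq: "fact_of_list \<tau>s = \<tau>" and len: "length \<tau>s = ?k"
      using fact_of_list_map[OF hl] by (simp_all add: \<tau>s_def)
    have nid: "id \<notin> set \<tau>s"
    proof
      assume "id \<in> set \<tau>s"
      then have "id \<in> \<tau> ` {1..?k}"
        unfolding \<tau>s_def set_map set_upt atLeastLessThanSuc_atLeastAtMost .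
      then obtain l where "l \<in> {1..?k}" "\<tau> l = id"
        by (metis imageE)
      then show False
        using hl unfolding has_labels_def by blast
    qed
    have fact: "min_fact (Suc (length \<tau>s)) [?xs] (fact_of_list \<tau>s)"
      using sound labels eq len by (simp del: upt_Suc)
    then have "\<tau>s \<in> min_factorizations_k n (length \<tau>s)"
      using min_factorizations_k_iff[OF assms] nid by blast
    \<comment> \<open>Each factor takes at least 1 from the total \<open>n - 1\<close>, which bounds
      the number of factors.\<close>
    then have "(\<Sum>\<tau>\<leftarrow>\<tau>s. cycle_length \<tau> - 1) = n - 1" "\<forall>\<tau>\<in>set \<tau>s. cycle_length \<tau> - 1 \<ge> 1"
      by (auto simp: min_factorizations_k_def)
    moreover from this(2) have "length \<tau>s \<le> (\<Sum>\<tau>\<leftarrow>\<tau>s. cycle_length \<tau> - 1)"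
      by (induction \<tau>s) auto
    ultimately have "length \<tau>s \<in> {1..n - 1}"
      using k len by simp
    then show ?thesis
      using memb fact nid \<tau> eq R_def by metis
  qed
  have tree_unique: "t = t'" if "R \<tau>s t" "R \<tau>s t'" for \<tau>s t t'
    using corr_tree_unique[OF _ _ dist] that R_def by blast
  have list_unique: "\<tau>s = \<tau>s'"
    if "R \<tau>s t" "R \<tau>s' t" "\<tau>s \<in> min_factorizations n" "\<tau>s' \<in> min_factorizations n" for \<tau>s \<tau>s' t
  proof -
    have eq: "fact_of_list \<tau>s = fact_of_list \<tau>s'"
      using corr_fact_unique[OF _ _ dist] that(1,2) R_def by blast
    have "{1..length \<tau>s} = {1..length \<tau>s'}"
      using has_labels_fact_of_list[of \<tau>s] has_labels_fact_of_list[of \<tau>s'] has_labels_unique that(3,4)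
      unfolding memb eq by blast
    from arg_cong[OF this, of card] have len: "length \<tau>s = length \<tau>s'"
      by simp
    then show ?thesis
    proof (rule nth_equalityI)
      fix i assume "i < length \<tau>s"
      then show "\<tau>s ! i = \<tau>s' ! i"
        using fun_cong[OF eq, of "Suc i"] len by (simp add: fact_of_list_def)
    qed
  qed
  \<comment> \<open>Totality makes the choice possible; uniqueness in the two directions gives
    injectivity and surjectivity.\<close>
  define f where "f \<tau>s = (SOME t. R \<tau>s t \<and> t \<in> labelled_trees n)" for \<tau>s
  have f: "R \<tau>s (f \<tau>s) \<and> f \<tau>s \<in> labelled_trees n" if "\<tau>s \<in> min_factorizations n" for \<tau>s
    unfolding f_def by (rule someI_ex[OF total[OF that]])
  have "bij_betw f (min_factorizations n) (labelled_trees n)"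
  proof (rule bij_betw_imageI)
    show "inj_on f (min_factorizations n)"
      by (rule inj_onI) (metis f list_unique)
    show "f ` min_factorizations n = labelled_trees n"
    proof
      show "f ` min_factorizations n \<subseteq> labelled_trees n"
        using f by blast
      show "labelled_trees n \<subseteq> f ` min_factorizations n"
      proof
        fix t assume "t \<in> labelled_trees n"
        then obtain \<tau>s where "R \<tau>s t" "\<tau>s \<in> min_factorizations n"
          using surj by blast
        then show "t \<in> f ` min_factorizations n"
          using f tree_unique by blast
      qed
    qed
  qed
  then show ?thesis
    by (rule exI[of _ f])
qed

end
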